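(* Let $G$ be a finite group. Suppose there exist integers $1\le j<k$ such that $Z_{K_i}>Z_{K_{i-1}}$ and $[K_i,G]\le K_{i-1}$ for all integers $i$ with $j\le i\le k$. Then there is a prime $p$ such that $K_k/K_{j-1}$ and $Z_{K_k}/Z_{K_{j-1}}$ are $p$-groups. In particular, $K_i/K_{i-1}$ and $Z_{K_i}/Z_{K_{i-1}}$ are elementary abelian $p$-groups for every integer $i$ with $j\le i\le k$.
   Context: All groups are finite. For $\chi\in\mathrm{Irr}(G)$, the center of $\chi$ is $Z(\chi)=\{g\in G : |\chi(g)|=\chi(1)\}$. For a nonabelian group $H$, let $\mathcal{X}_H=\{\chi\in\mathrm{Irr}(H) : Z(\chi)>Z(H)\}$ (strict containment) and define $K(H)=\bigcap_{\chi\in\mathcal{X}_H}\ker(\chi)$; if $H$ is abelian, set $K(H)=H$. Define normal subgroups $K_i$ of $G$ by $K_0=1$ and $K_{i+1}/K_{i}=K(G/K_{i})$ for $i\ge 0$. For a normal subgroup $N$ of $G$, $Z_N$ is defined by $Z_N/N=Z(G/N)$. *)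

theory Defs
  imports "HOL-Algebra.Algebra" "Jordan_Normal_Form.Matrix"
begin

definition mat_trace :: "complex mat \<Rightarrow> complex" where
  "mat_trace A = (\<Sum>i<dim_row A. A $$ (i, i))"

definition is_rep :: "('c, 'd) monoid_scheme \<Rightarrow> nat \<Rightarrow> ('c \<Rightarrow> complex mat) \<Rightarrow> bool" where
  "is_rep H n \<rho> \<longleftrightarrow>
     (\<forall>g \<in> carrier H. \<rho> g \<in> carrier_mat n n) \<and>
     \<rho> \<one>\<^bsub>H\<^esub> = 1\<^sub>m n \<and>
     (\<forall>g \<in> carrier H. \<forall>h \<in> carrier H. \<rho> (g \<otimes>\<^bsub>H\<^esub> h) = \<rho> g * \<rho> h)"

definition invariant_subspace ::
  "('c, 'd) monoid_scheme \<Rightarrow> nat \<Rightarrow> ('c \<Rightarrow> complex mat) \<Rightarrow> complex vec set \<Rightarrow> bool" where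
  "invariant_subspace H n \<rho> W \<longleftrightarrow>
     W \<subseteq> carrier_vec n \<and> 0\<^sub>v n \<in> W \<and>
     (\<forall>v \<in> W. \<forall>w \<in> W. v + w \<in> W) \<and>
     (\<forall>c::complex. \<forall>v \<in> W. c \<cdot>\<^sub>v v \<in> W) \<and>
     (\<forall>g \<in> carrier H. \<forall>v \<in> W. \<rho> g *\<^sub>v v \<in> W)"

definition irreducible_rep :: "('c, 'd) monoid_scheme \<Rightarrow> nat \<Rightarrow> ('c \<Rightarrow> complex mat) \<Rightarrow> bool" where
  "irreducible_rep H n \<rho> \<longleftrightarrow> is_rep H n \<rho> \<and> n > 0 \<and>
     (\<forall>W. invariant_subspace H n \<rho> W \<longrightarrow> W = {0\<^sub>v n} \<or> W = carrier_vec n)"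

definition Irr :: "('c, 'd) monoid_scheme \<Rightarrow> ('c \<Rightarrow> complex) set" where
  "Irr H = {\<chi>. \<exists>n \<rho>. irreducible_rep H n \<rho> \<and>
              \<chi> = (\<lambda>g. if g \<in> carrier H then mat_trace (\<rho> g) else 0)}"

definition char_center :: "('c, 'd) monoid_scheme \<Rightarrow> ('c \<Rightarrow> complex) \<Rightarrow> 'c set" where
  "char_center H \<chi> = {g \<in> carrier H. cmod (\<chi> g) = cmod (\<chi> \<one>\<^bsub>H\<^esub>)}"

definition char_ker :: "('c, 'd) monoid_scheme \<Rightarrow> ('c \<Rightarrow> complex) \<Rightarrow> 'c set" where
  "char_ker H \<chi> = {g \<in> carrier H. \<chi> g = \<chi> \<one>\<^bsub>H\<^esub>}"

definition group_center :: "('c, 'd) monoid_scheme \<Rightarrow> 'c set" where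
  "group_center H = {z \<in> carrier H. \<forall>g \<in> carrier H. z \<otimes>\<^bsub>H\<^esub> g = g \<otimes>\<^bsub>H\<^esub> z}"

definition XX :: "('c, 'd) monoid_scheme \<Rightarrow> ('c \<Rightarrow> complex) set" where
  "XX H = {\<chi> \<in> Irr H. group_center H \<subset> char_center H \<chi>}"

definition KK :: "('c, 'd) monoid_scheme \<Rightarrow> 'c set" where
  "KK H = (if comm_group H then carrier H
           else carrier H \<inter> (\<Inter>\<chi> \<in> XX H. char_ker H \<chi>))"

text \<open>K_0 = 1, K_{i+1}/K_i = K(G/K_i); the preimage in G of a subgroup of G Mod N
  (a set of cosets) is the union of those cosets.\<close>
primrec Kseq :: "('a, 'b) monoid_scheme \<Rightarrow> nat \<Rightarrow> 'a set" where
  "Kseq G 0 = {\<one>\<^bsub>G\<^esub>}"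
| "Kseq G (Suc i) = \<Union> (KK (G Mod Kseq G i))"

definition ZN :: "('a, 'b) monoid_scheme \<Rightarrow> 'a set \<Rightarrow> 'a set" where
  "ZN G N = \<Union> (group_center (G Mod N))"

definition subquot :: "('a, 'b) monoid_scheme \<Rightarrow> 'a set \<Rightarrow> 'a set \<Rightarrow> 'a set monoid" where
  "subquot G A B = (G\<lparr>carrier := A\<rparr>) Mod B"

definition is_p_group :: "nat \<Rightarrow> ('c, 'd) monoid_scheme \<Rightarrow> bool" where
  "is_p_group p H \<longleftrightarrow> group H \<and> (\<exists>a. order H = p ^ a)"

definition elementary_abelian_p_group :: "nat \<Rightarrow> ('c, 'd) monoid_scheme \<Rightarrow> bool" where
  "elementary_abelian_p_group p H \<longleftrightarrow> is_p_group p H \<and> comm_group H \<and>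
     (\<forall>x \<in> carrier H. x [^]\<^bsub>H\<^esub> p = \<one>\<^bsub>H\<^esub>)"

end

theory Submission
  imports Defs "Jordan_Normal_Form.Schur_Decomposition" "Jordan_Normal_Form.Spectral_Radius"
begin

text \<open>
  Since \<open>Z(\<chi>) / ker \<chi> = Z(H / ker \<chi>)\<close> and every normal subgroup \<open>N\<close> is an intersection of kernels of
  irreducible characters, \<open>K(H)\<close> is the intersection of all normal \<open>N\<close> with \<open>Z_N > Z(H)\<close>. This removes
  characters from the problem. Work in \<open>H = G / K_{i-1}\<close>, where \<open>K = K(H)\<close> is central. For
  \<open>b \<in> Z_K - Z(H)\<close> the map \<open>g \<mapsto> [b,g]\<close> is a homomorphism and its image \<open>[b,H]\<close> is a normal subgroup
  with \<open>b \<in> Z_{[b,H]}\<close>, so \<open>[b,H] = K\<close>. If \<open>K\<close> has an element of prime order \<open>p\<close>, then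
  \<open>[b^p,H] = K^p < K\<close>, whence \<open>b^p\<close> is central; thus \<open>Z_K / Z(H)\<close> and \<open>K\<close> have exponent \<open>p\<close>.

  Suppose the next step had a different prime \<open>q\<close>. Then \<open>K_{i+1} / K_{i-1}\<close> is still central in \<open>H\<close>,
  and for \<open>a \<in> Z_{K_{i+1}} - Z_{K_i}\<close> the subgroup \<open>[a^p,H] = [a,H]^p\<close> has no elements of order \<open>p\<close>,
  so it does not contain \<open>K\<close>. Hence \<open>a^p\<close> is central in \<open>H\<close>, and together with
  \<open>a^q \<in> Z_{K_i}\<close> this gives \<open>a \<in> Z_{K_i}\<close>, a contradiction.
\<close>

section \<open>Complex matrices of finite order\<close>

lemma mat_trace_mult_comm:
  assumes A: "A \<in> carrier_mat n m" and B: "B \<in> carrier_mat m n"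
  shows "mat_trace (A * B) = mat_trace (B * A)"
proof -
  have "mat_trace (A * B) = (\<Sum>i<n. \<Sum>k<m. A $$ (i,k) * B $$ (k,i))"
    unfolding mat_trace_def using A B by (auto simp: scalar_prod_def atLeast0LessThan intro!: sum.cong)
  also have "\<dots> = (\<Sum>k<m. \<Sum>i<n. B $$ (k,i) * A $$ (i,k))"
    by (subst sum.swap) (simp add: mult.commute)
  also have "\<dots> = mat_trace (B * A)"
    unfolding mat_trace_def using A B by (auto simp: scalar_prod_def atLeast0LessThan intro!: sum.cong)
  finally show ?thesis .
qed

lemma mat_trace_smult_one [simp]: "mat_trace (c \<cdot>\<^sub>m 1\<^sub>m n) = of_nat n * c"
  by (simp add: mat_trace_def)

lemma mat_trace_one [simp]: "mat_trace (1\<^sub>m n) = of_nat n"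
  by (simp add: mat_trace_def)

lemma mat_trace_add:
  assumes "A \<in> carrier_mat n n" "B \<in> carrier_mat n n"
  shows "mat_trace (A + B) = mat_trace A + mat_trace B"
  using assms by (simp add: mat_trace_def sum.distrib)

text \<open>In the sum over \<open>k\<close> for entry \<open>(i,j)\<close>, the factor
  \<open>A $$ (i,k)\<close> vanishes for \<open>k < i\<close> and \<open>B $$ (k,j)\<close> for
  \<open>k > j\<close>, so only \<open>i \<le> k \<le> j\<close> can contribute.\<close>

lemma upper_triangular_mult:
  fixes A :: "'a :: comm_ring_1 mat"
  assumes A: "A \<in> carrier_mat n n" "upper_triangular A"
    and B: "B \<in> carrier_mat n n" "upper_triangular B"
  shows "upper_triangular (A * B)"
    and "i < n \<Longrightarrow> (A * B) $$ (i, i) = A $$ (i, i) * B $$ (i, i)"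
proof -
  have ent: "(A * B) $$ (i, j) = (\<Sum>k<n. A $$ (i,k) * B $$ (k,j))" if "i < n" "j < n" for i j
    using A B that by (auto simp: scalar_prod_def atLeast0LessThan intro!: sum.cong)
  show "upper_triangular (A * B)"
  proof (rule upper_triangularI)
    fix i j assume ij: "j < i" "i < dim_row (A * B)"
    have "A $$ (i,k) * B $$ (k,j) = 0" if "k < n" for k
    proof (cases "k < i")
      case True then show ?thesis using upper_triangularD[OF A(2), of k i] ij A by simp
    next
      case False then show ?thesis using upper_triangularD[OF B(2), of j k] ij B that by simp
    qed
    then show "(A * B) $$ (i, j) = 0" using ent[of i j] ij A by simp
  qed
  assume i: "i < n"
  have "A $$ (i,k) * B $$ (k,i) = (if k = i then A $$ (i,i) * B $$ (i,i) else 0)" if "k < n" for k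
    using upper_triangularD[OF A(2), of k i] upper_triangularD[OF B(2), of i k] A B i that
    by (cases k i rule: linorder_cases) auto
  then have "(\<Sum>k<n. A $$ (i,k) * B $$ (k,i)) = (\<Sum>k<n. if k = i then A $$ (i,i) * B $$ (i,i) else 0)"
    by (intro sum.cong) auto
  then show "(A * B) $$ (i, i) = A $$ (i, i) * B $$ (i, i)"
    using ent[of i i] i by simp
qed

lemma upper_triangular_pow:
  fixes A :: "'a :: comm_ring_1 mat"
  assumes A: "A \<in> carrier_mat n n" "upper_triangular A"
  shows "upper_triangular (A ^\<^sub>m k) \<and> (\<forall>i<n. (A ^\<^sub>m k) $$ (i, i) = A $$ (i, i) ^ k)"
proof (induction k)
  case 0 then show ?case using A by simp
next
  case (Suc k)
  then show ?case
    using upper_triangular_mult[of "A ^\<^sub>m k" n A] A by (simp add: mult.commute)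
qed

text \<open>This is the factorisation of \<open>T^k - c^k\<close> by \<open>T - c\<close>, with
  cofactor \<open>S\<close> the sum of \<open>c^(k-1-l) T^l\<close> over \<open>l < k\<close>. Its
  recursion is \<open>S T + c^k\<close>. The diagonal value matters later: in characteristic 0 and
  for nonzero \<open>c\<close> it makes \<open>S\<close> invertible.\<close>

lemma upper_triangular_power_factor:
  fixes T :: "'a :: comm_ring_1 mat"
  assumes T: "T \<in> carrier_mat n n" "upper_triangular T" and diag: "\<And>i. i < n \<Longrightarrow> T $$ (i,i) = c"
  shows "\<exists>S \<in> carrier_mat n n. upper_triangular S \<and>
           (\<forall>i<n. S $$ (i,i) = of_nat k * c ^ (k - 1)) \<and>
           (T - c \<cdot>\<^sub>m 1\<^sub>m n) * S = T ^\<^sub>m k - c ^ k \<cdot>\<^sub>m 1\<^sub>m n"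
proof (induction k)
  case 0
  show ?case by (rule bexI[of _ "0\<^sub>m n n"]) (use T in \<open>auto simp: one_mat_def\<close>)
next
  case (Suc k)
  then obtain S where S: "S \<in> carrier_mat n n" "upper_triangular S"
    and dS: "\<And>i. i < n \<Longrightarrow> S $$ (i,i) = of_nat k * c ^ (k - 1)"
    and eq: "(T - c \<cdot>\<^sub>m 1\<^sub>m n) * S = T ^\<^sub>m k - c ^ k \<cdot>\<^sub>m 1\<^sub>m n" by blast
  define C where "C = c ^ k \<cdot>\<^sub>m (1\<^sub>m n :: 'a mat)"
  define D where "D = T - c \<cdot>\<^sub>m 1\<^sub>m n"
  have C: "C \<in> carrier_mat n n" and D: "D \<in> carrier_mat n n" unfolding C_def D_def using T
    by (auto intro!: minus_carrier_mat)
  note ST = upper_triangular_mult[OF S T]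
  have 1: "upper_triangular (S * T + C)"
    using upper_triangularD[OF ST(1)] S T unfolding C_def by (auto intro!: upper_triangularI)
  have 2: "(S * T + C) $$ (i,i) = of_nat (Suc k) * c ^ k" if "i < n" for i
    using ST(2)[OF that] that S T dS[OF that] diag[OF that] unfolding C_def
    by (cases k) (auto simp: algebra_simps)
  have "D * (S * T + C) = D * (S * T) + D * C"
    by (rule mult_add_distrib_mat[OF D]) (use S T C in auto)
  also have "D * (S * T) = (T ^\<^sub>m k - C) * T"
    using assoc_mult_mat[OF D S(1) T(1)] eq unfolding D_def C_def by simp
  also have "\<dots> = T ^\<^sub>m Suc k - C * T"
    using minus_mult_distrib_mat[OF _ C T(1), of "T ^\<^sub>m k"] T by simp
  also have "C * T = c ^ k \<cdot>\<^sub>m T"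
    unfolding C_def using T by (subst mult_smult_assoc_mat[of _ n n]) auto
  also have "D * C = c ^ k \<cdot>\<^sub>m D"
    unfolding C_def using D by (subst mult_smult_distrib[of _ n n]) auto
  also have "T ^\<^sub>m Suc k - c ^ k \<cdot>\<^sub>m T + c ^ k \<cdot>\<^sub>m D = T ^\<^sub>m Suc k - c ^ Suc k \<cdot>\<^sub>m 1\<^sub>m n"
    by (rule eq_matI) (use T in \<open>auto simp: D_def algebra_simps\<close>)
  finally have 3: "D * (S * T + C) = T ^\<^sub>m Suc k - c ^ Suc k \<cdot>\<^sub>m 1\<^sub>m n" .
  show ?case
    by (rule bexI[of _ "S * T + C"]) (use 1 2 3 S T C in \<open>auto simp: D_def\<close>)
qed

text \<open>Since \<open>T^m = 1\<close> and \<open>c^m = 1\<close>, the factorisation of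
  \<open>T^m - c^m\<close> reads \<open>(T - c) S = 0\<close> with \<open>S\<close> invertible,
  which forces \<open>T = c\<close> without any appeal to diagonalisability.\<close>

lemma upper_triangular_finite_order_imp_scalar:
  fixes T :: "'a :: field_char_0 mat"
  assumes T: "T \<in> carrier_mat n n" "upper_triangular T" and diag: "\<And>i. i < n \<Longrightarrow> T $$ (i,i) = c"
    and m: "m > 0" and pow: "T ^\<^sub>m m = 1\<^sub>m n"
  shows "T = c \<cdot>\<^sub>m 1\<^sub>m n"
proof (cases "n = 0")
  case True then show ?thesis using T by auto
next
  case False
  have "c ^ m = 1"
    using upper_triangular_pow[OF T, of m] False diag[of 0] unfolding pow by auto
  then have c: "c \<noteq> 0" using m by (auto simp: power_0_left)
  obtain S where S: "S \<in> carrier_mat n n" "upper_triangular S"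
    and dS: "\<And>i. i < n \<Longrightarrow> S $$ (i,i) = of_nat m * c ^ (m - 1)"
    and eq: "(T - c \<cdot>\<^sub>m 1\<^sub>m n) * S = T ^\<^sub>m m - c ^ m \<cdot>\<^sub>m 1\<^sub>m n"
    using upper_triangular_power_factor[OF T diag, where k = m] by blast
  define D where "D = T - c \<cdot>\<^sub>m 1\<^sub>m n"
  have D: "D \<in> carrier_mat n n" unfolding D_def using T by (auto intro!: minus_carrier_mat)
  have DS: "D * S = 0\<^sub>m n n"
    unfolding D_def eq pow \<open>c ^ m = 1\<close> by (rule eq_matI) auto
  have "det S \<noteq> 0"
    using upper_triangular_imp_det_eq_0_iff[OF S] S(1) dS c m by (auto simp: diag_mat_def)
  from det_non_zero_imp_unit[OF S(1) this, of "()"]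
  obtain R where R: "R \<in> carrier_mat n n" "S * R = 1\<^sub>m n"
    unfolding Units_def by (auto simp: ring_mat_simps)
  have "D = D * (S * R)" using R D by simp
  also have "\<dots> = D * S * R" using assoc_mult_mat[OF D S(1) R(1)] by simp
  also have "\<dots> = 0\<^sub>m n n" unfolding DS using R by simp
  finally have D0: "D = 0\<^sub>m n n" .
  have "T $$ (i,j) = (c \<cdot>\<^sub>m 1\<^sub>m n) $$ (i,j)" if "i < n" "j < n" for i j
    using arg_cong[OF D0, of "\<lambda>M. M $$ (i,j)"] that T unfolding D_def by simp
  then show ?thesis using T by (intro eq_matI) auto
qed

text \<open>This is the equality case of the triangle inequality: after rotation by the direction of
  the sum, \<open>n\<close> real parts that are each at most 1 add up to \<open>n\<close>.\<close>

lemma unit_complex_sum_maximal: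
  fixes t :: "nat \<Rightarrow> complex"
  assumes u: "\<And>i. i < n \<Longrightarrow> cmod (t i) = 1" and s: "cmod (\<Sum>i<n. t i) = real n"
  shows "\<exists>c. \<forall>i<n. t i = c"
proof (cases "n = 0")
  case False
  \<comment> \<open>The mean of the \<open>t i\<close>; the hypothesis on the sum says that it has
    modulus 1, and it turns out to be the common value.\<close>
  define v where "v = (\<Sum>i<n. t i) / of_nat n"
  have v: "cmod v = 1" unfolding v_def using s False by (simp add: norm_divide)
  then have vv: "v * cnj v = 1" using complex_norm_square[of v] by simp
  have r: "Re (t i * cnj v) \<le> 1" if "i < n" for i
    using complex_Re_le_cmod[of "t i * cnj v"] u[OF that] v by (simp add: norm_mult)
  have "(\<Sum>i<n. t i * cnj v) = of_nat n"
    using vv False unfolding sum_distrib_right[symmetric] v_def by (simp add: field_simps)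
  then have "(\<Sum>i<n. Re (t i * cnj v)) = real n"
    by (metis Re_sum of_real_of_nat_eq Re_complex_of_real)
  then have "(\<Sum>i<n. 1 - Re (t i * cnj v)) = 0"
    by (simp add: sum_subtractf)
  then have re: "Re (t i * cnj v) = 1" if "i < n" for i
    using r that by (subst (asm) sum_nonneg_eq_0_iff) auto
  have "t i = v" if "i < n" for i
  proof -
    have "cmod (t i * cnj v) = 1" using u[OF that] v by (simp add: norm_mult)
    then have "t i * cnj v = 1"
      using re[OF that] by (simp add: complex_eq_iff cmod_def)
    then have "t i * (v * cnj v) = v" by (simp add: mult.left_commute)
    then show ?thesis using vv by simp
  qed
  then show ?thesis by blast
qed simp

text \<open>After Schur triangularisation the diagonal consists of roots of unity. A trace of
  modulus \<open>n\<close> makes them all equal, and a triangular matrix of finite order with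
  constant diagonal is scalar. Applied to \<open>\<rho> g\<close>, this identifies the elements of
  the centre of a character.\<close>

lemma finite_order_mat_trace_norm_imp_scalar:
  fixes A :: "complex mat"
  assumes A: "A \<in> carrier_mat n n" and m: "m > 0" and pow: "A ^\<^sub>m m = 1\<^sub>m n"
    and tr: "cmod (mat_trace A) = real n"
  shows "\<exists>c. A = c \<cdot>\<^sub>m 1\<^sub>m n"
proof -
  obtain es where es: "char_poly A = (\<Prod>a\<leftarrow>es. [:- a, 1:])"
    using char_poly_factorized[OF A] by blast
  obtain T P Q where T: "similar_mat_wit A T P Q" "upper_triangular T"
    using schur_decomposition[OF A es] by (metis prod_cases3)
  note w = similar_mat_witD2[OF A T(1)]
  have Tc: "T \<in> carrier_mat n n" and P: "P \<in> carrier_mat n n" and Q: "Q \<in> carrier_mat n n"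
    and PQ: "P * Q = 1\<^sub>m n" "Q * P = 1\<^sub>m n" and AT: "A = P * T * Q" using w by auto
  have trT: "mat_trace A = mat_trace T"
  proof -
    have "mat_trace A = mat_trace (Q * (P * T))"
      unfolding AT by (rule mat_trace_mult_comm) (use P Tc Q in auto)
    also have "Q * (P * T) = T"
      using assoc_mult_mat[OF Q P Tc] PQ Tc by simp
    finally show ?thesis .
  qed
  have "T ^\<^sub>m m = Q * A ^\<^sub>m m * P"
    using similar_mat_wit_pow_id[OF similar_mat_wit_sym[OF T(1)]] .
  then have powT: "T ^\<^sub>m m = 1\<^sub>m n" unfolding pow using Q PQ by simp
  have "cmod (T $$ (i,i)) = 1" if "i < n" for i
  proof -
    have "T $$ (i,i) ^ m = 1"
      using upper_triangular_pow[OF Tc T(2), of m] that unfolding powT by auto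
    then have "cmod (T $$ (i,i)) ^ m = 1" by (metis norm_power norm_one)
    then show ?thesis using power_eq_imp_eq_base[of "cmod (T $$ (i,i))" m 1] m by simp
  qed
  moreover have "cmod (\<Sum>i<n. T $$ (i,i)) = real n"
    using tr[unfolded trT] Tc by (simp add: mat_trace_def)
  ultimately obtain c where c: "\<forall>i<n. T $$ (i,i) = c"
    using unit_complex_sum_maximal[of n "\<lambda>i. T $$ (i,i)"] by auto
  have "T = c \<cdot>\<^sub>m 1\<^sub>m n"
    by (rule upper_triangular_finite_order_imp_scalar[OF Tc T(2) _ m powT]) (use c in auto)
  then have "A = c \<cdot>\<^sub>m 1\<^sub>m n"
    unfolding AT using P Q PQ
    by (simp add: mult_smult_distrib[OF P one_carrier_mat] mult_smult_assoc_mat[OF P Q])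
  then show ?thesis by blast
qed

lemma finite_order_mat_trace_imp_one:
  fixes A :: "complex mat"
  assumes A: "A \<in> carrier_mat n n" and m: "m > 0" and pow: "A ^\<^sub>m m = 1\<^sub>m n"
    and tr: "mat_trace A = of_nat n"
  shows "A = 1\<^sub>m n"
proof (cases "n = 0")
  case True then show ?thesis using A by auto
next
  case False
  obtain c where c: "A = c \<cdot>\<^sub>m 1\<^sub>m n"
    using finite_order_mat_trace_norm_imp_scalar[OF A m pow] tr by auto
  then have "c = 1" using tr False by simp
  then show ?thesis using c by (auto simp: one_mat_def)
qed

section \<open>Bases of subspaces\<close>

text \<open>If \<open>n < d\<close>, padding \<open>B\<close> with zero rows and \<open>C\<close>
  with zero columns gives square matrices with \<open>C0 * B0 = 1\<close>. Then
  \<open>B0 * C0 = 1\<close> as well, although row \<open>n\<close> of \<open>B0\<close> is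
  zero.\<close>

lemma left_inverse_dim_le:
  fixes B :: "'a :: field mat"
  assumes B: "B \<in> carrier_mat n d" and C: "C \<in> carrier_mat d n" and CB: "C * B = 1\<^sub>m d"
  shows "d \<le> n"
proof (rule ccontr)
  assume "\<not> d \<le> n"
  then have nd: "n < d" by simp
  define C0 where "C0 = mat d d (\<lambda>(i,j). if j < n then C $$ (i,j) else 0)"
  define B0 where "B0 = mat d d (\<lambda>(i,j). if i < n then B $$ (i,j) else 0)"
  have c: "C0 \<in> carrier_mat d d" "B0 \<in> carrier_mat d d" unfolding C0_def B0_def by auto
  have "C0 * B0 = 1\<^sub>m d"
  proof (rule eq_matI)
    fix i j assume ij: "i < dim_row (1\<^sub>m d :: 'a mat)" "j < dim_col (1\<^sub>m d :: 'a mat)"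
    then have "(C0 * B0) $$ (i,j) = (\<Sum>k<d. C0 $$ (i,k) * B0 $$ (k,j))"
      using c by (simp add: scalar_prod_def atLeast0LessThan)
    also have "\<dots> = (\<Sum>k<d. if k < n then C $$ (i,k) * B $$ (k,j) else 0)"
      using ij unfolding C0_def B0_def by (intro sum.cong) auto
    also have "\<dots> = (\<Sum>k<n. C $$ (i,k) * B $$ (k,j))"
      using nd by (simp add: sum.If_cases Int_def lessThan_def) (rule sum.cong, auto)
    also have "\<dots> = (C * B) $$ (i,j)"
      using ij B C by (simp add: scalar_prod_def atLeast0LessThan)
    finally show "(C0 * B0) $$ (i,j) = 1\<^sub>m d $$ (i,j)" unfolding CB .
  qed (use c in auto)
  then have 1: "B0 * C0 = 1\<^sub>m d" using mat_mult_left_right_inverse c by blast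
  have "(B0 * C0) $$ (n,n) = 0"
    using nd c by (simp add: scalar_prod_def) (auto simp: B0_def)
  then show False unfolding 1 using nd by simp
qed

lemma mult_mat_vec_mem_subspace:
  fixes B :: "'a :: comm_ring_1 mat"
  assumes W: "W \<subseteq> carrier_vec n" "0\<^sub>v n \<in> W" "\<And>v w. v \<in> W \<Longrightarrow> w \<in> W \<Longrightarrow> v + w \<in> W"
      "\<And>c v. v \<in> W \<Longrightarrow> c \<cdot>\<^sub>v v \<in> W"
    and B: "B \<in> carrier_mat n d" "\<And>j. j < d \<Longrightarrow> col B j \<in> W" and x: "x \<in> carrier_vec d"
  shows "B *\<^sub>v x \<in> W"
proof -
  \<comment> \<open>Induction over the partial combinations of the first \<open>k\<close> columns;
    \<open>k = d\<close> is the product itself.\<close>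
  have "vec n (\<lambda>i. \<Sum>j<k. B $$ (i,j) * x $ j) \<in> W" if "k \<le> d" for k
    using that
  proof (induction k)
    case 0
    have "vec n (\<lambda>i. \<Sum>j<0. B $$ (i,j) * x $ j) = 0\<^sub>v n" by (rule eq_vecI) auto
    then show ?case using W by simp
  next
    case (Suc k)
    have "vec n (\<lambda>i. \<Sum>j<Suc k. B $$ (i,j) * x $ j)
        = vec n (\<lambda>i. \<Sum>j<k. B $$ (i,j) * x $ j) + x $ k \<cdot>\<^sub>v col B k"
      using B Suc.prems by (intro eq_vecI) (auto simp: mult.commute)
    then show ?case using Suc W(3,4) B by simp
  qed
  moreover have "B *\<^sub>v x = vec n (\<lambda>i. \<Sum>j<d. B $$ (i,j) * x $ j)"
    using B x by (intro eq_vecI) (auto simp: scalar_prod_def atLeast0LessThan intro!: sum.cong)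
  ultimately show ?thesis by simp
qed

text \<open>Choosing the number of columns of \<open>B\<close> maximal makes them a basis of \<open>W\<close>:
  a vector \<open>w\<close> of \<open>W\<close> outside the column span would contribute the further column \<open>w - B C w\<close>,
  and a suitable multiple of a row of \<open>1 - B C\<close> extends the left inverse.\<close>

lemma subspace_basis_with_left_inverse:
  fixes W :: "'a :: field vec set"
  assumes W: "W \<subseteq> carrier_vec n" "0\<^sub>v n \<in> W" "\<And>v w. v \<in> W \<Longrightarrow> w \<in> W \<Longrightarrow> v + w \<in> W"
      "\<And>c v. v \<in> W \<Longrightarrow> c \<cdot>\<^sub>v v \<in> W"
  obtains d B C where "B \<in> carrier_mat n d" "C \<in> carrier_mat d n" "C * B = 1\<^sub>m d"
    "\<And>x. x \<in> carrier_vec d \<Longrightarrow> B *\<^sub>v x \<in> W" "\<And>w. w \<in> W \<Longrightarrow> B *\<^sub>v (C *\<^sub>v w) = w"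
proof -
  define P where "P d \<longleftrightarrow> (\<exists>B C. B \<in> carrier_mat n d \<and> C \<in> carrier_mat d n \<and> C * B = 1\<^sub>m d \<and>
    (\<forall>j<d. col B j \<in> W))" for d
  have P0: "P 0" unfolding P_def
    by (rule exI[of _ "0\<^sub>m n 0"], rule exI[of _ "0\<^sub>m 0 n"]) auto
  have le: "d \<le> n" if "P d" for d
    using that left_inverse_dim_le unfolding P_def by blast
  define d where "d = (GREATEST d. P d)"
  have Pd: "P d" unfolding d_def by (rule GreatestI_nat[where P = P, OF P0 le])
  have mx: "e \<le> d" if "P e" for e unfolding d_def by (rule Greatest_le_nat[where P = P, OF that le])
  obtain B C where B: "B \<in> carrier_mat n d" and C: "C \<in> carrier_mat d n" and CB: "C * B = 1\<^sub>m d"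
    and cB: "\<And>j. j < d \<Longrightarrow> col B j \<in> W" using Pd unfolding P_def by blast
  have im: "B *\<^sub>v x \<in> W" if "x \<in> carrier_vec d" for x
    by (rule mult_mat_vec_mem_subspace[OF W B cB that])
  have fixw: "B *\<^sub>v (C *\<^sub>v w) = w" if w: "w \<in> W" for w
  proof (rule ccontr)
    assume neq: "B *\<^sub>v (C *\<^sub>v w) \<noteq> w"
    have wc: "w \<in> carrier_vec n" using w W by auto
    have Cw: "C *\<^sub>v w \<in> carrier_vec d" using C wc by auto
    have BCw: "B *\<^sub>v (C *\<^sub>v w) \<in> carrier_vec n" using B Cw by auto
    define u where "u = w + (-1) \<cdot>\<^sub>v (B *\<^sub>v (C *\<^sub>v w))"
    have uW: "u \<in> W" unfolding u_def using W(3,4) w im[OF Cw] by blast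
    then have uc: "u \<in> carrier_vec n" using W by auto
    have CBv: "C *\<^sub>v (B *\<^sub>v v) = v" if "v \<in> carrier_vec d" for v
      using assoc_mult_mat_vec[OF C B that] CB that by simp
    have Cu: "C *\<^sub>v u = 0\<^sub>v d"
    proof -
      have "C *\<^sub>v u = C *\<^sub>v w + C *\<^sub>v ((-1) \<cdot>\<^sub>v (B *\<^sub>v (C *\<^sub>v w)))"
        unfolding u_def by (rule mult_add_distrib_mat_vec[OF C wc]) (use BCw in simp)
      also have "\<dots> = C *\<^sub>v w + (-1) \<cdot>\<^sub>v (C *\<^sub>v w)"
        using mult_mat_vec[OF C BCw, of "-1"] CBv[OF Cw] by simp
      also have "\<dots> = 0\<^sub>v d" using C wc by (intro eq_vecI) auto
      finally show ?thesis .
    qed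
    have "\<exists>i<n. u $ i \<noteq> 0"
    proof (rule ccontr)
      assume "\<not> ?thesis"
      then have "w $ i = (B *\<^sub>v (C *\<^sub>v w)) $ i" if "i < n" for i
        using that wc BCw B unfolding u_def by auto
      then have "B *\<^sub>v (C *\<^sub>v w) = w" using wc B by (intro eq_vecI) auto
      then show False using neq by simp
    qed
    then obtain i0 where i0: "i0 < n" "u $ i0 \<noteq> 0" by blast
    define Q where "Q = 1\<^sub>m n - B * C"
    have BC: "B * C \<in> carrier_mat n n" using B C by auto
    have Q: "Q \<in> carrier_mat n n" unfolding Q_def using BC by (rule minus_carrier_mat)
    have QB: "Q * B = 0\<^sub>m n d"
    proof -
      have "Q * B = 1\<^sub>m n * B - B * C * B"
        unfolding Q_def by (rule minus_mult_distrib_mat[OF one_carrier_mat BC B])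
      also have "B * C * B = B" using assoc_mult_mat[OF B C B] CB B by simp
      finally show ?thesis using B by (auto intro!: eq_matI)
    qed
    have Qu: "Q *\<^sub>v u = u"
    proof -
      have "Q *\<^sub>v u = 1\<^sub>m n *\<^sub>v u - B * C *\<^sub>v u"
        unfolding Q_def by (rule minus_mult_distrib_mat_vec[OF one_carrier_mat BC uc])
      also have "B * C *\<^sub>v u = 0\<^sub>v n" using assoc_mult_mat_vec[OF B C uc] Cu B by auto
      finally show ?thesis using uc by simp
    qed
    \<comment> \<open>\<open>Q B = 0\<close> makes every row of \<open>Q\<close> orthogonal to the
      old columns. Since \<open>Q u = u\<close>, row \<open>i0\<close> pairs with \<open>u\<close>
      to the nonzero coordinate \<open>u $ i0\<close>, and the scaling turns this into 1.\<close>
    define r where "r = inverse (u $ i0) \<cdot>\<^sub>v row Q i0"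
    have rc: "r \<in> carrier_vec n" unfolding r_def using Q i0 by simp
    have rB: "r \<bullet> col B j = 0" if "j < d" for j
    proof -
      have "r \<bullet> col B j = inverse (u $ i0) * (Q * B) $$ (i0, j)"
        unfolding r_def using Q B i0 that by simp
      then show ?thesis unfolding QB using i0 that by simp
    qed
    have ru: "r \<bullet> u = 1"
    proof -
      have "r \<bullet> u = inverse (u $ i0) * (Q *\<^sub>v u) $ i0"
        unfolding r_def using Q uc i0 by simp
      then show ?thesis unfolding Qu using i0 by simp
    qed
    define B' where "B' = mat n (Suc d) (\<lambda>(i,j). if j < d then B $$ (i,j) else u $ i)"
    define C' where "C' = mat (Suc d) n (\<lambda>(i,j). if i < d then C $$ (i,j) else r $ j)"
    have c': "B' \<in> carrier_mat n (Suc d)" "C' \<in> carrier_mat (Suc d) n"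
      unfolding B'_def C'_def by auto
    have colB: "col B' j = (if j < d then col B j else u)" if "j < Suc d" for j
      using that B uc unfolding B'_def by (intro eq_vecI) auto
    have rowC: "row C' i = (if i < d then row C i else r)" if "i < Suc d" for i
      using that C rc unfolding C'_def by (intro eq_vecI) auto
    have "C' * B' = 1\<^sub>m (Suc d)"
    proof (rule eq_matI)
      fix i j assume "i < dim_row (1\<^sub>m (Suc d) :: 'a mat)" "j < dim_col (1\<^sub>m (Suc d) :: 'a mat)"
      then have ij: "i < Suc d" "j < Suc d" by auto
      have e: "(C' * B') $$ (i,j) = row C' i \<bullet> col B' j" using c' ij by simp
      have 1: "row C i \<bullet> col B j = 1\<^sub>m d $$ (i,j)" if "i < d" "j < d"
        using arg_cong[OF CB, of "\<lambda>M. M $$ (i,j)"] that B C by simp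
      have 2: "row C i \<bullet> u = 0" if "i < d"
        using arg_cong[OF Cu, of "\<lambda>v. v $ i"] that C by simp
      show "(C' * B') $$ (i,j) = 1\<^sub>m (Suc d) $$ (i,j)"
        unfolding e colB[OF ij(2)] rowC[OF ij(1)] using 1 2 rB ru ij by auto
    qed (use c' in auto)
    then have "P (Suc d)"
      unfolding P_def using c' colB uW cB by (intro exI[of _ B'] exI[of _ C']) auto
    then show False using mx[of "Suc d"] by simp
  qed
  show thesis by (rule that[OF B C CB im fixw])
qed

section \<open>Irreducible representations\<close>

lemma mult_mat_unit_vec:
  fixes A :: "'a :: semiring_1 mat"
  assumes "A \<in> carrier_mat nr nc" "j < nc"
  shows "A *\<^sub>v unit_vec nc j = col A j"
  using assms by (intro eq_vecI) auto

lemma is_repD: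
  assumes "is_rep H n \<rho>"
  shows "g \<in> carrier H \<Longrightarrow> \<rho> g \<in> carrier_mat n n"
    and "\<rho> \<one>\<^bsub>H\<^esub> = 1\<^sub>m n"
    and "g \<in> carrier H \<Longrightarrow> h \<in> carrier H \<Longrightarrow> \<rho> (g \<otimes>\<^bsub>H\<^esub> h) = \<rho> g * \<rho> h"
  using assms unfolding is_rep_def by blast+

text \<open>Elements of a finite group have \<open>|H|\<close>-th power 1, so the results on
  matrices of finite order apply to every \<open>\<rho> g\<close>.\<close>

lemma rep_finite_order:
  assumes "group H" "finite (carrier H)" "is_rep H n \<rho>" "g \<in> carrier H"
  shows "\<rho> g ^\<^sub>m Coset.order H = 1\<^sub>m n" and "Coset.order H > 0"
proof -
  interpret group H by fact
  note r = is_repD[OF assms(3)]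
  have "\<rho> (g [^]\<^bsub>H\<^esub> k) = \<rho> g ^\<^sub>m k" for k :: nat
  proof (induction k)
    case 0 then show ?case using r(1)[OF assms(4)] r(2) by simp
  next
    case (Suc k) then show ?case using r(3) assms(4) by simp
  qed
  from this[of "Coset.order H"] show "\<rho> g ^\<^sub>m Coset.order H = 1\<^sub>m n"
    using pow_order_eq_1[OF assms(4)] r(2) by simp
  show "Coset.order H > 0" using order_gt_0_iff_finite assms(2) by simp
qed

lemma rep_trace_imp_one:
  assumes "group H" "finite (carrier H)" "is_rep H n \<rho>" "g \<in> carrier H" "mat_trace (\<rho> g) = of_nat n"
  shows "\<rho> g = 1\<^sub>m n"
  using finite_order_mat_trace_imp_one[OF is_repD(1)[OF assms(3,4)] rep_finite_order(2,1)[OF assms(1-4)] assms(5)] .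

lemma rep_trace_norm_imp_scalar:
  assumes "group H" "finite (carrier H)" "is_rep H n \<rho>" "g \<in> carrier H" "cmod (mat_trace (\<rho> g)) = real n"
  shows "\<exists>c. \<rho> g = c \<cdot>\<^sub>m 1\<^sub>m n"
  using finite_order_mat_trace_norm_imp_scalar[OF is_repD(1)[OF assms(3,4)] rep_finite_order(2,1)[OF assms(1-4)] assms(5)] .

lemma is_rep_comp_hom:
  assumes "is_rep Q n \<rho>" "f \<in> hom H Q" "f \<one>\<^bsub>H\<^esub> = \<one>\<^bsub>Q\<^esub>"
  shows "is_rep H n (\<rho> \<circ> f)"
  using assms unfolding is_rep_def by (auto simp: hom_def Pi_iff)

text \<open>The left regular representation, written as permutation matrices with respect to an
  enumeration \<open>e\<close> of the group. It is faithful because \<open>q\<close> can be read off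
  from where it sends \<open>e 0\<close>.\<close>

lemma faithful_rep_exists:
  assumes "group Q" and fin: "finite (carrier Q)"
  shows "\<exists>n \<rho>. is_rep Q n \<rho> \<and> (\<forall>q \<in> carrier Q. \<rho> q = 1\<^sub>m n \<longrightarrow> q = \<one>\<^bsub>Q\<^esub>)"
proof -
  interpret group Q by fact
  define m where "m = card (carrier Q)"
  have m: "m > 0" unfolding m_def using fin by (metis card_gt_0_iff empty_iff one_closed)
  obtain e where e: "bij_betw e {..<m} (carrier Q)"
    using ex_bij_betw_nat_finite[OF fin] unfolding m_def atLeast0LessThan by blast
  have ec: "e i \<in> carrier Q" if "i < m" for i using e that by (auto simp: bij_betw_def)
  define \<rho> where "\<rho> q = mat m m (\<lambda>(i,j). if e i = q \<otimes>\<^bsub>Q\<^esub> e j then 1 else (0::complex))" for q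
  have c: "\<rho> q \<in> carrier_mat m m" for q unfolding \<rho>_def by simp
  have inj: "e i = e j \<longleftrightarrow> i = j" if "i < m" "j < m" for i j
    using e that by (auto simp: bij_betw_def inj_on_def)
  have one: "\<rho> \<one>\<^bsub>Q\<^esub> = 1\<^sub>m m"
    by (rule eq_matI) (auto simp: \<rho>_def ec inj)
  have mult: "\<rho> (q \<otimes>\<^bsub>Q\<^esub> r) = \<rho> q * \<rho> r" if q: "q \<in> carrier Q" and r: "r \<in> carrier Q" for q r
  proof (rule eq_matI)
    fix i j assume "i < dim_row (\<rho> q * \<rho> r)" "j < dim_col (\<rho> q * \<rho> r)"
    then have ij: "i < m" "j < m" using c[of q] c[of r] by auto
    have "r \<otimes>\<^bsub>Q\<^esub> e j \<in> e ` {..<m}" using r ec[OF ij(2)] e by (auto simp: bij_betw_def)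
    then obtain k where k: "k < m" "e k = r \<otimes>\<^bsub>Q\<^esub> e j" by auto
    have "(\<rho> q * \<rho> r) $$ (i,j) = (\<Sum>l<m. \<rho> q $$ (i,l) * \<rho> r $$ (l,j))"
      using ij c[of q] c[of r] by (simp add: scalar_prod_def atLeast0LessThan)
    also have "\<dots> = (\<Sum>l<m. if l = k then \<rho> q $$ (i,k) else 0)"
      using ij k inj unfolding \<rho>_def by (intro sum.cong) (auto simp flip: k(2))
    also have "\<dots> = \<rho> q $$ (i,k)" using k by simp
    also have "\<dots> = \<rho> (q \<otimes>\<^bsub>Q\<^esub> r) $$ (i,j)"
      using ij k(1) q r ec unfolding \<rho>_def by (simp add: k(2) m_assoc)
    finally show "\<rho> (q \<otimes>\<^bsub>Q\<^esub> r) $$ (i,j) = (\<rho> q * \<rho> r) $$ (i,j)" by simp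
  qed (use c[of q] c[of r] c[of "q \<otimes>\<^bsub>Q\<^esub> r"] in auto)
  have "q = \<one>\<^bsub>Q\<^esub>" if q: "q \<in> carrier Q" and "\<rho> q = 1\<^sub>m m" for q
  proof -
    have "\<rho> q $$ (0,0) = 1" using that m by simp
    then have "e 0 = q \<otimes>\<^bsub>Q\<^esub> e 0" using m unfolding \<rho>_def by (auto split: if_splits)
    then show ?thesis using q ec[OF m] by (metis r_cancel_one)
  qed
  moreover have "is_rep Q m \<rho>" unfolding is_rep_def using c one mult by blast
  ultimately show ?thesis by blast
qed

text \<open>The trace of a representation is the sum of the traces of a subrepresentation and its quotient.
  If \<open>g\<close> acted trivially on both, its trace would be the degree, forcing \<open>\<rho> g\<close> to be the identity.\<close>

lemma reducible_rep_smaller: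
  assumes H: "group H" "finite (carrier H)" and rep: "is_rep H n \<rho>"
    and W: "invariant_subspace H n \<rho> W" "W \<noteq> {0\<^sub>v n}" "W \<noteq> carrier_vec n"
    and g: "g \<in> carrier H" "\<rho> g \<noteq> 1\<^sub>m n"
  shows "\<exists>d \<sigma>. d < n \<and> is_rep H d \<sigma> \<and> \<sigma> g \<noteq> 1\<^sub>m d \<and> (\<forall>x \<in> carrier H. \<rho> x = 1\<^sub>m n \<longrightarrow> \<sigma> x = 1\<^sub>m d)"
proof -
  interpret group H by fact
  note r = is_repD[OF rep]
  note Wi = W(1)[unfolded invariant_subspace_def]
  have Wc: "W \<subseteq> carrier_vec n" using Wi by blast
  obtain d B C where B: "B \<in> carrier_mat n d" and C: "C \<in> carrier_mat d n" and CB: "C * B = 1\<^sub>m d"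
    and im: "\<And>x. x \<in> carrier_vec d \<Longrightarrow> B *\<^sub>v x \<in> W" and fixW: "\<And>w. w \<in> W \<Longrightarrow> B *\<^sub>v (C *\<^sub>v w) = w"
    using subspace_basis_with_left_inverse[of W n] Wi by metis
  define Q where "Q = 1\<^sub>m n - B * C"
  have BC: "B * C \<in> carrier_mat n n" using B C by auto
  have Q: "Q \<in> carrier_mat n n" unfolding Q_def using BC by (rule minus_carrier_mat)
  \<comment> \<open>\<open>Q\<close> is a projection with kernel \<open>W\<close>. Its range
    \<open>W'\<close> is a complement of \<open>W\<close> and stands in for the quotient space; it
    need not be invariant.\<close>
  define W' where "W' = (\<lambda>v. Q *\<^sub>v v) ` carrier_vec n"
  have "0\<^sub>v n \<in> W'" unfolding W'_def
    using Q by (intro image_eqI[of _ _ "0\<^sub>v n"]) auto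
  moreover have "v + w \<in> W'" if vw: "v \<in> W'" "w \<in> W'" for v w
  proof -
    obtain v' w' where "v = Q *\<^sub>v v'" "w = Q *\<^sub>v w'" "v' \<in> carrier_vec n" "w' \<in> carrier_vec n"
      using vw unfolding W'_def by auto
    then show ?thesis unfolding W'_def
      by (intro image_eqI[of _ _ "v' + w'"]) (auto simp: mult_add_distrib_mat_vec[OF Q])
  qed
  moreover have "c \<cdot>\<^sub>v v \<in> W'" if "v \<in> W'" for c v
  proof -
    obtain v' where "v = Q *\<^sub>v v'" "v' \<in> carrier_vec n" using \<open>v \<in> W'\<close> unfolding W'_def by auto
    then show ?thesis unfolding W'_def
      by (intro image_eqI[of _ _ "c \<cdot>\<^sub>v v'"]) (auto simp: mult_mat_vec[OF Q])
  qed
  moreover have W'c: "W' \<subseteq> carrier_vec n" unfolding W'_def using Q by auto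
  ultimately obtain d' B' C2 where B': "B' \<in> carrier_mat n d'" and C2: "C2 \<in> carrier_mat d' n"
    and CB2: "C2 * B' = 1\<^sub>m d'"
    and im': "\<And>x. x \<in> carrier_vec d' \<Longrightarrow> B' *\<^sub>v x \<in> W'" and fixW': "\<And>w. w \<in> W' \<Longrightarrow> B' *\<^sub>v (C2 *\<^sub>v w) = w"
    using subspace_basis_with_left_inverse[of W' n] by metis
  have CBm: "C * (B * M) = M" if "M \<in> carrier_mat d k" for M k
    using assoc_mult_mat[OF C B that] CB that by simp
  have QM: "Q * M = M - B * (C * M)" if "M \<in> carrier_mat n k" for M k
    unfolding Q_def using minus_mult_distrib_mat[OF one_carrier_mat BC that] assoc_mult_mat[OF B C that] that
    by simp
  have split: "M = B * (C * M) + Q * M" if M: "M \<in> carrier_mat n k" for M k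
    unfolding QM[OF M] using B C M by (intro eq_matI) auto
  have QB: "Q * B = 0\<^sub>m n d" unfolding QM[OF B] CB using B by (intro eq_matI) auto
  have QQ: "Q * Q = Q"
  proof -
    have "C * Q = C - C * (B * C)"
      unfolding Q_def using mult_minus_distrib_mat[OF C one_carrier_mat BC] C by simp
    then have "C * Q = 0\<^sub>m d n" using CBm[OF C] C by (auto intro!: eq_matI)
    then show ?thesis unfolding QM[OF Q] using B Q by (auto intro!: eq_matI)
  qed
  have QW': "Q *\<^sub>v w = w" if "w \<in> W'" for w
    using that QQ assoc_mult_mat_vec[OF Q Q] unfolding W'_def by force
  have colfix: "B * (C * M) = M" if M: "M \<in> carrier_mat n k" "\<And>j. j < k \<Longrightarrow> col M j \<in> W" for M k
  proof (rule mat_col_eqI)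
    fix j assume "j < dim_col M"
    then show "col (B * (C * M)) j = col M j"
      using M fixW[of "col M j"] C B by (simp add: col_mult2[OF B mult_carrier_mat[OF C M(1)]] col_mult2[OF C M(1)])
  qed (use B C M in auto)
  have colB: "col B j \<in> W" if "j < d" for j
    using im[of "unit_vec d j"] that B by (metis mult_mat_unit_vec unit_vec_carrier)
  have rB: "B * (C * (\<rho> x * B)) = \<rho> x * B" if x: "x \<in> carrier H" for x
  proof (rule colfix)
    show "\<rho> x * B \<in> carrier_mat n d" using r(1)[OF x] B by simp
    fix j assume j: "j < d"
    then show "col (\<rho> x * B) j \<in> W"
      using col_mult2[OF r(1)[OF x] B j] colB[OF j] x Wi by simp
  qed
  \<comment> \<open>Composing with \<open>Q\<close> makes the coordinate map vanish on
    \<open>W\<close>, so that it gives coordinates on the quotient by \<open>W\<close>;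
    \<open>C2\<close> alone need not do so.\<close>
  define C' where "C' = C2 * Q"
  have C': "C' \<in> carrier_mat d' n" unfolding C'_def using C2 Q by simp
  have BC': "B' * C' = Q"
  proof (rule mat_col_eqI)
    fix j assume "j < dim_col Q"
    then have j: "j < n" using Q by simp
    have "col Q j \<in> W'" unfolding W'_def using Q j by (metis imageI mult_mat_unit_vec unit_vec_carrier)
    then show "col (B' * C') j = col Q j" unfolding C'_def
      using fixW' j by (simp add: col_mult2[OF B' mult_carrier_mat[OF C2 Q]] col_mult2[OF C2 Q])
  qed (use B' C' Q in auto)
  have "Q * B' = B'"
  proof (rule mat_col_eqI)
    fix j assume "j < dim_col B'"
    then have j: "j < d'" using B' by simp
    have "col B' j \<in> W'" using im'[of "unit_vec d' j"] j B' by (metis mult_mat_unit_vec unit_vec_carrier)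
    then show "col (Q * B') j = col B' j" using QW' j by (simp add: col_mult2[OF Q B'])
  qed (use B' Q in auto)
  then have CB': "C' * B' = 1\<^sub>m d'" unfolding C'_def using assoc_mult_mat[OF C2 Q B'] CB2 by simp
  have C'B: "C' * B = 0\<^sub>m d' d" unfolding C'_def using assoc_mult_mat[OF C2 Q B] QB C2 by simp
  \<comment> \<open>\<open>\<alpha>\<close> is the restriction to \<open>W\<close> in the basis
    \<open>B\<close>, and \<open>\<beta>\<close> the action on the quotient by \<open>W\<close> in
    the basis \<open>B'\<close>.\<close>
  define \<alpha> where "\<alpha> x = C * (\<rho> x * B)" for x
  define \<beta> where "\<beta> x = C' * (\<rho> x * B')" for x
  have \<alpha>c: "\<alpha> x \<in> carrier_mat d d" and \<beta>c: "\<beta> x \<in> carrier_mat d' d'" if "x \<in> carrier H" for x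
    unfolding \<alpha>_def \<beta>_def using r(1)[OF that] B C B' C' by auto
  have rep_\<alpha>: "is_rep H d \<alpha>"
    unfolding is_rep_def
  proof (intro conjI ballI)
    show "\<alpha> \<one>\<^bsub>H\<^esub> = 1\<^sub>m d" unfolding \<alpha>_def r(2) using B CB by simp
    fix x y assume x: "x \<in> carrier H" and y: "y \<in> carrier H"
    have ry: "\<rho> y * B \<in> carrier_mat n d" using r(1)[OF y] B by simp
    have "\<alpha> x * \<alpha> y = C * ((\<rho> x * B) * \<alpha> y)"
      unfolding \<alpha>_def[of x] by (rule assoc_mult_mat) (use C r(1)[OF x] B \<alpha>c[OF y] in auto)
    also have "(\<rho> x * B) * \<alpha> y = \<rho> x * (B * \<alpha> y)"
      by (rule assoc_mult_mat) (use r(1)[OF x] B \<alpha>c[OF y] in auto)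
    also have "B * \<alpha> y = \<rho> y * B" unfolding \<alpha>_def by (rule rB[OF y])
    also have "\<rho> x * (\<rho> y * B) = \<rho> (x \<otimes>\<^bsub>H\<^esub> y) * B"
      using assoc_mult_mat[OF r(1)[OF x] r(1)[OF y] B] r(3)[OF x y] by simp
    finally show "\<alpha> (x \<otimes>\<^bsub>H\<^esub> y) = \<alpha> x * \<alpha> y" unfolding \<alpha>_def by simp
  qed (rule \<alpha>c)
  \<comment> \<open>Invariance of \<open>W\<close> keeps \<open>\<rho> x * B\<close> in the column
    span of \<open>B\<close>, which \<open>C'\<close> annihilates. This discards the
    \<open>W\<close> component below and makes \<open>\<beta>\<close> multiplicative although
    \<open>W'\<close> may fail to be invariant.\<close>
  have kill: "C' * (\<rho> x * (B * M)) = 0\<^sub>m d' k" if x: "x \<in> carrier H" and M: "M \<in> carrier_mat d k" for x M k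
  proof -
    have "\<rho> x * (B * M) = (\<rho> x * B) * M" using assoc_mult_mat[OF r(1)[OF x] B M] by simp
    also have "\<rho> x * B = B * \<alpha> x" unfolding \<alpha>_def using rB[OF x] by simp
    also have "B * \<alpha> x * M = B * (\<alpha> x * M)" by (rule assoc_mult_mat[OF B \<alpha>c[OF x] M])
    finally have "C' * (\<rho> x * (B * M)) = C' * B * (\<alpha> x * M)"
      using assoc_mult_mat[OF C' B mult_carrier_mat[OF \<alpha>c[OF x] M]] by simp
    then show ?thesis unfolding C'B using \<alpha>c[OF x] M by simp
  qed
  have rep_\<beta>: "is_rep H d' \<beta>"
    unfolding is_rep_def
  proof (intro conjI ballI)
    show "\<beta> \<one>\<^bsub>H\<^esub> = 1\<^sub>m d'" unfolding \<beta>_def r(2) using B' CB' by simp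
    fix x y assume x: "x \<in> carrier H" and y: "y \<in> carrier H"
    have rx: "\<rho> x \<in> carrier_mat n n" and ry: "\<rho> y * B' \<in> carrier_mat n d'"
      using r(1)[OF x] r(1)[OF y] B' by auto
    have CrB: "C * (\<rho> y * B') \<in> carrier_mat d d'" using C ry by simp
    have "\<beta> x * \<beta> y = C' * ((\<rho> x * B') * \<beta> y)"
      unfolding \<beta>_def[of x] by (rule assoc_mult_mat) (use C' rx B' \<beta>c[OF y] in auto)
    also have "(\<rho> x * B') * \<beta> y = \<rho> x * (B' * \<beta> y)"
      by (rule assoc_mult_mat) (use rx B' \<beta>c[OF y] in auto)
    also have "B' * \<beta> y = Q * (\<rho> y * B')"
      unfolding \<beta>_def using assoc_mult_mat[OF B' C' ry] BC' by simp
    finally have 1: "\<beta> x * \<beta> y = C' * (\<rho> x * (Q * (\<rho> y * B')))" .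
    have "\<beta> (x \<otimes>\<^bsub>H\<^esub> y) = C' * (\<rho> x * (\<rho> y * B'))"
      unfolding \<beta>_def r(3)[OF x y] using assoc_mult_mat[OF rx r(1)[OF y] B'] by simp
    also have "\<rho> x * (\<rho> y * B') = \<rho> x * (B * (C * (\<rho> y * B')) + Q * (\<rho> y * B'))"
      using split[OF ry] by simp
    also have "\<dots> = \<rho> x * (B * (C * (\<rho> y * B'))) + \<rho> x * (Q * (\<rho> y * B'))"
      by (rule mult_add_distrib_mat[OF rx]) (use B C ry Q in auto)
    also have "C' * \<dots> = C' * (\<rho> x * (B * (C * (\<rho> y * B')))) + C' * (\<rho> x * (Q * (\<rho> y * B')))"
      by (rule mult_add_distrib_mat[OF C']) (use rx B C ry Q in auto)
    also have "\<dots> = \<beta> x * \<beta> y" unfolding kill[OF x CrB] 1[symmetric] using \<beta>c[OF x] \<beta>c[OF y] by simp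
    finally show "\<beta> (x \<otimes>\<^bsub>H\<^esub> y) = \<beta> x * \<beta> y" .
  qed (rule \<beta>c)
  have triv: "\<alpha> x = 1\<^sub>m d \<and> \<beta> x = 1\<^sub>m d'" if "\<rho> x = 1\<^sub>m n" for x
    unfolding \<alpha>_def \<beta>_def that using B B' CB CB' by simp
  \<comment> \<open>Split \<open>\<rho> x\<close> by \<open>1 = B C + B' C'\<close> and move the
    left factors \<open>B\<close> and \<open>B'\<close> to the right inside the trace.\<close>
  have tr: "mat_trace (\<rho> x) = mat_trace (\<alpha> x) + mat_trace (\<beta> x)" if x: "x \<in> carrier H" for x
  proof -
    have rx: "\<rho> x \<in> carrier_mat n n" by (rule r(1)[OF x])
    have "mat_trace (\<rho> x) = mat_trace (B * (C * \<rho> x)) + mat_trace (Q * \<rho> x)"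
      by (subst split[OF rx], rule mat_trace_add) (use B C Q rx in auto)
    also have "mat_trace (B * (C * \<rho> x)) = mat_trace (C * \<rho> x * B)"
      by (rule mat_trace_mult_comm) (use B C rx in auto)
    also have "C * \<rho> x * B = \<alpha> x" unfolding \<alpha>_def by (rule assoc_mult_mat[OF C rx B])
    also have "Q * \<rho> x = B' * (C' * \<rho> x)"
      unfolding BC'[symmetric] by (rule assoc_mult_mat[OF B' C' rx])
    also have "mat_trace (B' * (C' * \<rho> x)) = mat_trace (C' * \<rho> x * B')"
      by (rule mat_trace_mult_comm) (use B' C' rx in auto)
    also have "C' * \<rho> x * B' = \<beta> x" unfolding \<beta>_def by (rule assoc_mult_mat[OF C' rx B'])
    finally show ?thesis .
  qed
  have "d < n"
  proof (rule ccontr)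
    assume "\<not> d < n"
    then have "d = n" using left_inverse_dim_le[OF B C CB] by simp
    then have "B * C = 1\<^sub>m n" using mat_mult_left_right_inverse[of C n B] B C CB by simp
    then have "v \<in> W" if "v \<in> carrier_vec n" for v
      using im[of "C *\<^sub>v v"] assoc_mult_mat_vec[OF B C that] that C by simp
    then show False using W(3) Wc by auto
  qed
  \<comment> \<open>If \<open>d' = n\<close>, then \<open>W'\<close> is the whole space and
    \<open>Q\<close> fixes every vector; but \<open>Q\<close> kills \<open>W\<close>, so
    \<open>W\<close> would be zero.\<close>
  moreover have "d' < n"
  proof (rule ccontr)
    assume "\<not> d' < n"
    then have "d' = n" using left_inverse_dim_le[OF B' C2 CB2] by simp
    then have "B' * C2 = 1\<^sub>m n" using mat_mult_left_right_inverse[of C2 n B'] B' C2 CB2 by simp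
    then have mem: "v \<in> W'" if "v \<in> carrier_vec n" for v
      using im'[of "C2 *\<^sub>v v"] assoc_mult_mat_vec[OF B' C2 that] that C2 by simp
    have "w = 0\<^sub>v n" if w: "w \<in> W" for w
    proof -
      have wc: "w \<in> carrier_vec n" using w Wc by auto
      have "w = Q *\<^sub>v w" using QW'[OF mem[OF wc]] by simp
      also have "\<dots> = w - B *\<^sub>v (C *\<^sub>v w)"
        unfolding Q_def using minus_mult_distrib_mat_vec[OF one_carrier_mat BC wc] assoc_mult_mat_vec[OF B C wc] wc
        by simp
      also have "\<dots> = 0\<^sub>v n" using fixW[OF w] wc by simp
      finally show ?thesis .
    qed
    then show False using W(2) Wi by auto
  qed
  moreover have "\<alpha> g \<noteq> 1\<^sub>m d \<or> \<beta> g \<noteq> 1\<^sub>m d'"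
  proof (rule ccontr)
    assume "\<not> ?thesis"
    then have "mat_trace (\<rho> g) = mat_trace (\<rho> \<one>\<^bsub>H\<^esub>)"
      using tr[OF g(1)] tr[OF one_closed] triv[OF r(2)] by simp
    then show False using rep_trace_imp_one[OF H rep g(1)] g(2) r(2) by simp
  qed
  ultimately show ?thesis using rep_\<alpha> rep_\<beta> triv by blast
qed

text \<open>Among the representations trivial on \<open>N\<close> but not at \<open>g\<close>, one
  of least degree is irreducible, since a proper invariant subspace would yield a smaller one. The
  faithful representation of \<open>H / N\<close>, pulled back to \<open>H\<close>, shows that there
  are such representations.\<close>

lemma irreducible_rep_separates:
  assumes H: "group H" "finite (carrier H)" and N: "N \<lhd> H" and g: "g \<in> carrier H" "g \<notin> N"
  obtains n \<rho> where "irreducible_rep H n \<rho>" "\<And>x. x \<in> N \<Longrightarrow> \<rho> x = 1\<^sub>m n" "\<rho> g \<noteq> 1\<^sub>m n"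
proof -
  interpret normal N H by fact
  define P where "P n \<longleftrightarrow> (\<exists>\<rho>. is_rep H n \<rho> \<and> (\<forall>x \<in> N. \<rho> x = 1\<^sub>m n) \<and> \<rho> g \<noteq> 1\<^sub>m n)" for n
  have "finite (carrier (H Mod N))" unfolding carrier_FactGroup using H by simp
  from faithful_rep_exists[OF factorgroup_is_group this]
  obtain n \<rho> where rep: "is_rep (H Mod N) n \<rho>"
    and faith: "\<And>q. q \<in> carrier (H Mod N) \<Longrightarrow> \<rho> q = 1\<^sub>m n \<Longrightarrow> q = \<one>\<^bsub>H Mod N\<^esub>" by blast
  have coset: "N #>\<^bsub>H\<^esub> x = N \<longleftrightarrow> x \<in> N" if "x \<in> carrier H" for x
    using that coset_join1[OF _ that] coset_join2[OF that] subgroup_axioms subset by blast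
  let ?f = "\<lambda>x. N #>\<^bsub>H\<^esub> x"
  have one: "?f \<one>\<^bsub>H\<^esub> = \<one>\<^bsub>H Mod N\<^esub>" using coset[of "\<one>\<^bsub>H\<^esub>"] by simp
  have "is_rep H n (\<rho> \<circ> ?f)" by (rule is_rep_comp_hom[OF rep r_coset_hom_Mod one])
  moreover have "(\<rho> \<circ> ?f) x = 1\<^sub>m n" if "x \<in> N" for x
    using coset[of x] that subset is_repD(2)[OF rep] by auto
  moreover have "(\<rho> \<circ> ?f) g \<noteq> 1\<^sub>m n"
    using faith[of "?f g"] coset[OF g(1)] g by (auto simp: carrier_FactGroup)
  ultimately have "P n" unfolding P_def by blast
  define n0 where "n0 = (LEAST n. P n)"
  have L: "P n0" unfolding n0_def by (rule LeastI[of P, OF \<open>P n\<close>])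
  obtain \<sigma> where \<sigma>: "is_rep H n0 \<sigma>" "\<And>x. x \<in> N \<Longrightarrow> \<sigma> x = 1\<^sub>m n0" "\<sigma> g \<noteq> 1\<^sub>m n0"
    using L unfolding P_def by blast
  \<comment> \<open>In degree 0 the only matrix is the identity, so \<open>g\<close> could not act
    nontrivially.\<close>
  have "n0 > 0"
  proof (rule ccontr)
    assume "\<not> n0 > 0"
    then have "\<sigma> g = 1\<^sub>m n0" using is_repD(1)[OF \<sigma>(1) g(1)] by auto
    then show False using \<sigma>(3) by simp
  qed
  moreover have "W = {0\<^sub>v n0} \<or> W = carrier_vec n0" if W: "invariant_subspace H n0 \<sigma> W" for W
  proof (rule ccontr)
    assume "\<not> ?thesis"
    then obtain d \<tau> where "d < n0" "is_rep H d \<tau>" "\<tau> g \<noteq> 1\<^sub>m d"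
      "\<forall>x \<in> carrier H. \<sigma> x = 1\<^sub>m n0 \<longrightarrow> \<tau> x = 1\<^sub>m d"
      using reducible_rep_smaller[OF H \<sigma>(1) W _ _ g(1) \<sigma>(3)] by blast
    then have "P d" unfolding P_def using \<sigma>(2) subset by blast
    then show False using \<open>d < n0\<close> not_less_Least unfolding n0_def by blast
  qed
  ultimately have "irreducible_rep H n0 \<sigma>" unfolding irreducible_rep_def using \<sigma>(1) by blast
  then show thesis using that \<sigma> by blast
qed

text \<open>Schur's lemma: an eigenspace of \<open>M\<close> is invariant under all
  \<open>\<rho> h\<close> and nonzero, hence everything.\<close>

lemma schur_scalar:
  assumes irr: "irreducible_rep H n \<rho>" and M: "M \<in> carrier_mat n n"
    and comm: "\<And>h. h \<in> carrier H \<Longrightarrow> M * \<rho> h = \<rho> h * M"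
  shows "\<exists>c. M = c \<cdot>\<^sub>m 1\<^sub>m n"
proof -
  have rep: "is_rep H n \<rho>" and n: "n > 0" using irr unfolding irreducible_rep_def by auto
  note r = is_repD[OF rep]
  obtain c where "eigenvalue M c" using spectrum_non_empty[OF M n] unfolding spectrum_def by auto
  then obtain v where v: "v \<in> carrier_vec n" "v \<noteq> 0\<^sub>v n" "M *\<^sub>v v = c \<cdot>\<^sub>v v"
    using M unfolding eigenvalue_def eigenvector_def by auto
  define W where "W = {w \<in> carrier_vec n. M *\<^sub>v w = c \<cdot>\<^sub>v w}"
  have "invariant_subspace H n \<rho> W"
    unfolding invariant_subspace_def
  proof (intro conjI allI ballI)
    show "W \<subseteq> carrier_vec n" unfolding W_def by auto
    show "0\<^sub>v n \<in> W" unfolding W_def using M by auto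
    show "v + w \<in> W" if "v \<in> W" "w \<in> W" for v w
      using that unfolding W_def
      by (auto simp: mult_add_distrib_mat_vec[OF M] smult_add_distrib_vec[of _ n])
    show "a \<cdot>\<^sub>v v \<in> W" if "v \<in> W" for a v
      using that unfolding W_def
      by (auto simp: mult_mat_vec[OF M] smult_smult_assoc mult.commute)
    show "\<rho> g *\<^sub>v w \<in> W" if g: "g \<in> carrier H" and w: "w \<in> W" for g w
    proof -
      have wc: "w \<in> carrier_vec n" and Xw: "M *\<^sub>v w = c \<cdot>\<^sub>v w" using w unfolding W_def by auto
      have "M *\<^sub>v (\<rho> g *\<^sub>v w) = (M * \<rho> g) *\<^sub>v w"
        by (rule assoc_mult_mat_vec[OF M r(1)[OF g] wc, symmetric])
      also have "\<dots> = \<rho> g *\<^sub>v (M *\<^sub>v w)"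
        unfolding comm[OF g] by (rule assoc_mult_mat_vec[OF r(1)[OF g] M wc])
      also have "\<dots> = c \<cdot>\<^sub>v (\<rho> g *\<^sub>v w)" unfolding Xw by (rule mult_mat_vec[OF r(1)[OF g] wc])
      finally show ?thesis unfolding W_def using r(1)[OF g] wc by auto
    qed
  qed
  moreover have "v \<in> W" unfolding W_def using v by auto
  ultimately have Wall: "W = carrier_vec n" using irr v(2) unfolding irreducible_rep_def by blast
  have "M = c \<cdot>\<^sub>m 1\<^sub>m n"
  proof (rule mat_col_eqI)
    fix j assume "j < dim_col (c \<cdot>\<^sub>m 1\<^sub>m n)"
    then have j: "j < n" by simp
    have "unit_vec n j \<in> W" unfolding Wall by simp
    then have "M *\<^sub>v unit_vec n j = c \<cdot>\<^sub>v unit_vec n j" unfolding W_def by simp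
    then show "col M j = col (c \<cdot>\<^sub>m 1\<^sub>m n) j" using mult_mat_unit_vec[OF M j] j by simp
  qed (use M in auto)
  then show ?thesis by blast
qed

section \<open>Commutators and relative centres\<close>

text \<open>The convention \<open>a g a^-1 g^-1\<close> is the one in which the theorem states
  \<open>[K_i,G] \<le> K_{i-1}\<close>.\<close>

definition gcomm :: "('a, 'b) monoid_scheme \<Rightarrow> 'a \<Rightarrow> 'a \<Rightarrow> 'a" where
  "gcomm G a g = a \<otimes>\<^bsub>G\<^esub> g \<otimes>\<^bsub>G\<^esub> inv\<^bsub>G\<^esub> a \<otimes>\<^bsub>G\<^esub> inv\<^bsub>G\<^esub> g"

lemma (in group_hom) hom_gcomm:
  assumes "a \<in> carrier G" "g \<in> carrier G"
  shows "h (gcomm G a g) = gcomm H (h a) (h g)"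
  using assms by (simp add: gcomm_def)

context group
begin

lemma gcomm_closed [simp]: "a \<in> carrier G \<Longrightarrow> g \<in> carrier G \<Longrightarrow> gcomm G a g \<in> carrier G"
  by (simp add: gcomm_def)

lemma mult_eq_gcomm:
  assumes "a \<in> carrier G" "g \<in> carrier G"
  shows "a \<otimes> g = gcomm G a g \<otimes> g \<otimes> a"
  using assms by (simp add: gcomm_def m_assoc)

text \<open>The commutator is the only \<open>c\<close> with \<open>a g = c g a\<close>; commutator
  identities can thus be checked without handling inverses.\<close>

lemma gcomm_eqI:
  assumes "a \<in> carrier G" "g \<in> carrier G" "c \<in> carrier G" "a \<otimes> g = c \<otimes> g \<otimes> a"
  shows "gcomm G a g = c"
proof -
  have "gcomm G a g \<otimes> (g \<otimes> a) = c \<otimes> (g \<otimes> a)"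
    using mult_eq_gcomm[OF assms(1,2)] assms by (simp add: m_assoc)
  then show ?thesis using assms by simp
qed

lemma gcomm_eq_one_iff:
  assumes "a \<in> carrier G" "g \<in> carrier G"
  shows "gcomm G a g = \<one> \<longleftrightarrow> a \<otimes> g = g \<otimes> a"
  using mult_eq_gcomm[OF assms] gcomm_eqI[OF assms one_closed] assms by auto

lemma group_center_iff:
  "z \<in> group_center G \<longleftrightarrow> z \<in> carrier G \<and> (\<forall>g \<in> carrier G. gcomm G z g = \<one>)"
  unfolding group_center_def using gcomm_eq_one_iff by auto

lemma group_centerD:
  assumes "z \<in> group_center G"
  shows "z \<in> carrier G" "g \<in> carrier G \<Longrightarrow> z \<otimes> g = g \<otimes> z"
  using assms unfolding group_center_def by auto

lemma group_center_subgroup: "subgroup (group_center G) G"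
proof
  show "x \<otimes> y \<in> group_center G" if x: "x \<in> group_center G" and y: "y \<in> group_center G" for x y
  proof -
    have c: "x \<in> carrier G" "y \<in> carrier G" using x y group_centerD(1) by auto
    have "(x \<otimes> y) \<otimes> g = g \<otimes> (x \<otimes> y)" if g: "g \<in> carrier G" for g
    proof -
      have "(x \<otimes> y) \<otimes> g = x \<otimes> (g \<otimes> y)" using group_centerD(2)[OF y g] c g by (simp add: m_assoc)
      also have "\<dots> = x \<otimes> g \<otimes> y" using c g by (simp add: m_assoc)
      also have "\<dots> = g \<otimes> (x \<otimes> y)" unfolding group_centerD(2)[OF x g] using c g by (simp add: m_assoc)
      finally show ?thesis .
    qed
    then show ?thesis using c unfolding group_center_def by blast
  qed
  show "inv x \<in> group_center G" if x: "x \<in> group_center G" for x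
  proof -
    have c: "x \<in> carrier G" using x group_centerD(1) by auto
    have "inv x \<otimes> g = g \<otimes> inv x" if g: "g \<in> carrier G" for g
    proof -
      have "inv x \<otimes> g = inv x \<otimes> (g \<otimes> x) \<otimes> inv x" using c g by (simp add: m_assoc)
      also have "\<dots> = inv x \<otimes> (x \<otimes> g) \<otimes> inv x" unfolding group_centerD(2)[OF x g] ..
      also have "\<dots> = g \<otimes> inv x" using c g by (simp flip: m_assoc)
      finally show ?thesis .
    qed
    then show ?thesis using c unfolding group_center_def by blast
  qed
qed (auto simp: group_center_def)

text \<open>In general \<open>[a, g h] = [a,g] g [a,h] g^-1\<close>. Centrality of the values
  removes the conjugation, so \<open>g \<mapsto> [a,g]\<close> is a homomorphism.\<close>

lemma gcomm_mult_right:
  assumes a: "a \<in> carrier G" and c: "\<And>g. g \<in> carrier G \<Longrightarrow> gcomm G a g \<in> group_center G"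
    and g: "g \<in> carrier G" and h: "h \<in> carrier G"
  shows "gcomm G a (g \<otimes> h) = gcomm G a g \<otimes> gcomm G a h"
proof (rule gcomm_eqI)
  note cg = group_centerD[OF c[OF g]] and ch = group_centerD[OF c[OF h]]
  have "a \<otimes> (g \<otimes> h) = (a \<otimes> g) \<otimes> h" using a g h by (simp add: m_assoc)
  also have "\<dots> = gcomm G a g \<otimes> g \<otimes> (a \<otimes> h)"
    unfolding mult_eq_gcomm[OF a g] using a g h by (simp add: m_assoc)
  also have "\<dots> = gcomm G a g \<otimes> (g \<otimes> gcomm G a h) \<otimes> h \<otimes> a"
    unfolding mult_eq_gcomm[OF a h] using a g h by (simp add: m_assoc)
  also have "g \<otimes> gcomm G a h = gcomm G a h \<otimes> g" using ch(2)[OF g] by simp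
  finally show "a \<otimes> (g \<otimes> h) = gcomm G a g \<otimes> gcomm G a h \<otimes> (g \<otimes> h) \<otimes> a"
    using a g h by (simp add: m_assoc)
qed (use a g h in auto)

text \<open>Each further factor \<open>a\<close> contributes one more \<open>[a,g]\<close>, which is
  central and can be moved past \<open>a^n\<close>.\<close>

lemma gcomm_pow_left:
  assumes a: "a \<in> carrier G" and g: "g \<in> carrier G" and c: "gcomm G a g \<in> group_center G"
  shows "gcomm G (a [^] (n::nat)) g = gcomm G a g [^] n"
proof (induction n)
  case 0
  then show ?case using g gcomm_eq_one_iff[OF one_closed g] by simp
next
  case (Suc n)
  let ?c = "gcomm G a g"
  have cc: "?c \<in> carrier G" using a g by simp
  have an: "a [^] n \<in> carrier G" using a by simp
  show ?case
  proof (rule gcomm_eqI)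
    have "a [^] Suc n \<otimes> g = a [^] n \<otimes> (a \<otimes> g)" using a g by (simp add: m_assoc)
    also have "\<dots> = (a [^] n \<otimes> ?c) \<otimes> g \<otimes> a"
      unfolding mult_eq_gcomm[OF a g] using a g an by (simp add: m_assoc)
    also have "a [^] n \<otimes> ?c = ?c \<otimes> a [^] n" using group_centerD(2)[OF c an] by simp
    also have "?c \<otimes> a [^] n \<otimes> g = ?c \<otimes> (a [^] n \<otimes> g)" using cc an g by (simp add: m_assoc)
    also have "a [^] n \<otimes> g = ?c [^] n \<otimes> g \<otimes> a [^] n" using mult_eq_gcomm[OF an g] Suc.IH by simp
    also have "?c \<otimes> (?c [^] n \<otimes> g \<otimes> a [^] n) \<otimes> a = (?c \<otimes> ?c [^] n) \<otimes> g \<otimes> (a [^] n \<otimes> a)"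
      using cc an g a by (simp add: m_assoc)
    also have "?c \<otimes> ?c [^] n = ?c [^] Suc n" using cc nat_pow_Suc2 by simp
    finally show "a [^] Suc n \<otimes> g = ?c [^] Suc n \<otimes> g \<otimes> a [^] Suc n" by simp
  qed (use a g in auto)
qed

lemma central_subgroup_normal:
  assumes "subgroup L G" "L \<subseteq> group_center G"
  shows "L \<lhd> G"
proof (rule normal_invI[OF assms(1)])
  fix x h assume x: "x \<in> carrier G" and h: "h \<in> L"
  note hc = group_centerD[OF subsetD[OF assms(2) h]]
  have "x \<otimes> h \<otimes> inv x = h" using hc(2)[OF x] hc(1) x by (metis inv_solve_right m_closed)
  then show "x \<otimes> h \<otimes> inv x \<in> L" using h by simp
qed

text \<open>The image of a homomorphism is a subgroup, and a subgroup of the centre is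
  normal.\<close>

lemma gcomm_image_normal:
  assumes a: "a \<in> carrier G" and c: "\<And>g. g \<in> carrier G \<Longrightarrow> gcomm G a g \<in> group_center G"
  shows "gcomm G a ` carrier G \<lhd> G"
proof (rule central_subgroup_normal)
  have "gcomm G a \<in> hom G G"
    using a gcomm_mult_right[OF a c] by (auto intro!: homI)
  then have "group_hom G G (gcomm G a)"
    using group_axioms by (simp add: group_hom_def group_hom_axioms_def)
  then show "subgroup (gcomm G a ` carrier G) G" by (rule group_hom.img_is_subgroup)
qed (use c in auto)

section \<open>Coprime exponents and groups of prime exponent\<close>

lemma subgroup_pow_closed:
  assumes "subgroup S G" "x \<in> S"
  shows "x [^] (n::nat) \<in> S"
  by (induction n) (use assms subgroup.one_closed subgroup.m_closed in fastforce)+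

text \<open>By Bezout \<open>p u = q v + 1\<close>, so \<open>x\<close> is a quotient of powers of
  \<open>x^p\<close> and \<open>x^q\<close>. The case \<open>p = 0\<close> is separate, because
  there coprimality forces \<open>q = 1\<close>.\<close>

lemma mem_subgroup_if_coprime_pows:
  assumes S: "subgroup S G" and x: "x \<in> carrier G" and pq: "coprime p (q::nat)"
    and p: "x [^] p \<in> S" and q: "x [^] q \<in> S"
  shows "x \<in> S"
proof (cases "p = 0")
  case True
  then show ?thesis using pq q x by simp
next
  case False
  then obtain u v where uv: "p * u = q * v + 1" using bezout_nat[of p q] pq by auto
  have "x [^] (p * u) = x [^] (q * v) \<otimes> x" unfolding uv using x by simp
  then have "x = inv (x [^] (q * v)) \<otimes> x [^] (p * u)"
    using x by (simp add: inv_solve_left)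
  moreover have "x [^] (q * v) \<in> S" "x [^] (p * u) \<in> S"
    using subgroup_pow_closed[OF S p, of u] subgroup_pow_closed[OF S q, of v] x by (simp_all add: nat_pow_pow)
  ultimately show ?thesis
    using S by (metis subgroup.m_closed subgroup.m_inv_closed)
qed

text \<open>A prime \<open>q\<close> other than \<open>p\<close> dividing the order would give, by
  Sylow's theorem with exponent 1, a subgroup of order \<open>q\<close>. Its elements have trivial
  \<open>p\<close>-th and \<open>q\<close>-th powers, hence are trivial.\<close>

lemma exponent_prime_imp_card_power:
  assumes fin: "finite (carrier G)" and p: "Factorial_Ring.prime (p::nat)"
    and e: "\<And>x. x \<in> carrier G \<Longrightarrow> x [^] p = \<one>"
  shows "\<exists>a. Coset.order G = p ^ a"
proof -
  have pos: "Coset.order G > 0" using fin order_gt_0_iff_finite by simp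
  have "q = p" if q: "Factorial_Ring.prime q" "q dvd Coset.order G" for q :: nat
  proof (rule ccontr)
    assume "q \<noteq> p"
    obtain m where m: "Coset.order G = q ^ 1 * m" using q(2) by auto
    obtain S where S: "subgroup S G" "card S = q ^ 1"
      using sylow_thm[OF q(1) group_axioms m fin] by blast
    have "\<not> S \<subseteq> {\<one>}"
      using card_mono[of "{\<one>}" S] S(2) prime_gt_1_nat[OF q(1)] by auto
    then obtain x where x: "x \<in> S" "x \<noteq> \<one>" by blast
    have xc: "x \<in> carrier G" using x S subgroup.subset by blast
    interpret S: group "G\<lparr>carrier := S\<rparr>" using subgroup.subgroup_is_group[OF S(1) group_axioms] .
    have "x [^] q = \<one>"
      using S.pow_order_eq_1[of x] x S(2) by (simp add: Coset.order_def flip: nat_pow_consistent)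
    then have "x \<in> {\<one>}"
      using mem_subgroup_if_coprime_pows[OF triv_subgroup xc, of p q] e[OF xc] primes_coprime[OF p q(1)] \<open>q \<noteq> p\<close>
      by simp
    then show False using x by simp
  qed
  then have "prime_factors (Coset.order G) \<subseteq> {p}" by (auto simp: in_prime_factors_iff)
  then have "Coset.order G = (\<Prod>q \<in> prime_factors (Coset.order G). q ^ multiplicity q (Coset.order G))"
    using pos prime_factorization_nat by simp
  moreover have "prime_factors (Coset.order G) = {} \<or> prime_factors (Coset.order G) = {p}"
    using \<open>prime_factors (Coset.order G) \<subseteq> {p}\<close> by auto
  ultimately show ?thesis
  proof (elim disjE)
    assume "prime_factors (Coset.order G) = {}"
    then have "Coset.order G = p ^ 0"
      using \<open>Coset.order G = (\<Prod>q \<in> prime_factors (Coset.order G). q ^ multiplicity q (Coset.order G))\<close> by simp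
    then show ?thesis by blast
  next
    assume "prime_factors (Coset.order G) = {p}"
    then have "Coset.order G = p ^ multiplicity p (Coset.order G)"
      using \<open>Coset.order G = (\<Prod>q \<in> prime_factors (Coset.order G). q ^ multiplicity q (Coset.order G))\<close> by simp
    then show ?thesis by blast
  qed
qed

end

section \<open>Cosets, quotient groups and the subgroups Z_N\<close>

context normal
begin

lemma coset_group_hom: "group_hom G (G Mod H) (\<lambda>x. H #> x)"
  using group_axioms factorgroup_is_group r_coset_hom_Mod
  by (simp add: group_hom_def group_hom_axioms_def)

lemma coset_eq_iff: "x \<in> carrier G \<Longrightarrow> H #> x = H \<longleftrightarrow> x \<in> H"
  using coset_join1[of H x] coset_join2[of x H] subgroup_axioms subset by blast

lemma coset_mem: "x \<in> carrier G \<Longrightarrow> H #> x \<in> carrier (G Mod H)"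
  by (simp add: carrier_FactGroup)

text \<open>Cosets are disjoint, so membership in a union of cosets is decided by the coset of the
  element. This unlocks \<open>ZN\<close> and \<open>Kseq\<close>, which are defined as
  unions.\<close>

lemma mem_Union_iff_coset:
  assumes "U \<subseteq> carrier (G Mod H)"
  shows "x \<in> \<Union>U \<longleftrightarrow> x \<in> carrier G \<and> H #> x \<in> U"
proof
  assume "x \<in> \<Union>U"
  then obtain u where u: "u \<in> U" "x \<in> u" by blast
  then obtain y where y: "y \<in> carrier G" "u = H #> y" using assms by (auto simp: carrier_FactGroup)
  then have xc: "x \<in> carrier G" using u elemrcos_carrier group_axioms by blast
  have "H #> y = H #> x" using repr_independence[of x H y] u y subgroup_axioms by simp
  then show "x \<in> carrier G \<and> H #> x \<in> U" using xc u y by simp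
next
  assume "x \<in> carrier G \<and> H #> x \<in> U"
  then show "x \<in> \<Union>U" using rcos_self[OF _ subgroup_axioms] by blast
qed

lemma coset_mem_center_iff:
  assumes z: "z \<in> carrier G"
  shows "H #> z \<in> group_center (G Mod H) \<longleftrightarrow> (\<forall>g \<in> carrier G. gcomm G z g \<in> H)"
proof -
  interpret Q: group "G Mod H" by (rule factorgroup_is_group)
  interpret \<pi>: group_hom G "G Mod H" "\<lambda>x. H #> x" by (rule coset_group_hom)
  have "gcomm (G Mod H) (H #> z) (H #> g) = \<one>\<^bsub>G Mod H\<^esub> \<longleftrightarrow> gcomm G z g \<in> H" if "g \<in> carrier G" for g
    using \<pi>.hom_gcomm[OF z that] coset_eq_iff[of "gcomm G z g"] z that by simp
  then show ?thesis
    unfolding Q.group_center_iff using coset_mem[OF z] by (auto simp: carrier_FactGroup)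
qed

text \<open>Centrality modulo \<open>H\<close> means that commutators become trivial modulo
  \<open>H\<close>. From here on Z_N is handled in this form, as the set of \<open>z\<close> with
  \<open>[z,G] \<le> N\<close>.\<close>

lemma mem_ZN_iff: "z \<in> ZN G H \<longleftrightarrow> z \<in> carrier G \<and> (\<forall>g \<in> carrier G. gcomm G z g \<in> H)"
  unfolding ZN_def using mem_Union_iff_coset[of "group_center (G Mod H)" z] coset_mem_center_iff[of z]
  by (auto simp: group_center_def)

lemma group_center_subset_ZN: "group_center G \<subseteq> ZN G H"
  using group_center_iff mem_ZN_iff by auto

lemma coset_mem_image_iff:
  assumes N: "N \<lhd> G" "H \<subseteq> N" and x: "x \<in> carrier G"
  shows "H #> x \<in> (\<lambda>x. H #> x) ` N \<longleftrightarrow> x \<in> N"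
proof
  interpret N: normal N G by fact
  assume "H #> x \<in> (\<lambda>x. H #> x) ` N"
  then obtain y where y: "y \<in> N" "H #> x = H #> y" by blast
  then have "x \<in> H #> y" using rcos_self[OF x subgroup_axioms] by simp
  then obtain h where "h \<in> H" "x = h \<otimes> y" unfolding r_coset_def by blast
  then show "x \<in> N" using N(2) y(1) by auto
qed blast

lemma normal_coset_image: "N \<lhd> G \<Longrightarrow> (\<lambda>x. H #> x) ` N \<lhd> (G Mod H)"
  by (rule normal.surj_hom_normal_subgroup[OF _ coset_group_hom]) (simp_all add: carrier_FactGroup)

text \<open>Commutators map to commutators, and \<open>N\<close> is a union of cosets of
  \<open>H\<close>, so a commutator lies in \<open>N\<close> exactly when its coset lies in the
  image of \<open>N\<close>. This transfers Z_N between \<open>G\<close> and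
  \<open>G / H\<close>.\<close>

lemma coset_mem_ZN_iff:
  assumes N: "N \<lhd> G" "H \<subseteq> N" and z: "z \<in> carrier G"
  shows "H #> z \<in> ZN (G Mod H) ((\<lambda>x. H #> x) ` N) \<longleftrightarrow> z \<in> ZN G N"
proof -
  interpret N: normal N G by fact
  interpret Q: normal "(\<lambda>x. H #> x) ` N" "G Mod H" by (rule normal_coset_image[OF N(1)])
  interpret \<pi>: group_hom G "G Mod H" "\<lambda>x. H #> x" by (rule coset_group_hom)
  have "gcomm (G Mod H) (H #> z) (H #> g) \<in> (\<lambda>x. H #> x) ` N \<longleftrightarrow> gcomm G z g \<in> N" if "g \<in> carrier G" for g
    using \<pi>.hom_gcomm[OF z that] coset_mem_image_iff[OF N, of "gcomm G z g"] z that by simp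
  then show ?thesis
    unfolding Q.mem_ZN_iff N.mem_ZN_iff using coset_mem[OF z] z by (auto simp: carrier_FactGroup)
qed

lemma ZN_normal: "ZN G H \<lhd> G"
proof -
  interpret Q: group "G Mod H" by (rule factorgroup_is_group)
  have "group_center (G Mod H) \<lhd> (G Mod H)"
    by (rule Q.central_subgroup_normal[OF Q.group_center_subgroup]) simp
  then show ?thesis unfolding ZN_def by (rule factgroup_subgroup_union_normal)
qed

end

lemma ZN_mono:
  assumes "A \<lhd> G" "B \<lhd> G" "A \<subseteq> B"
  shows "ZN G A \<subseteq> ZN G B"
  using normal.mem_ZN_iff[OF assms(1)] normal.mem_ZN_iff[OF assms(2)] assms(3) by blast

section \<open>Central subgroups minimal with respect to enlarging the centre\<close>

context group
begin

text \<open>The normal subgroup \<open>[b,G]\<close> satisfies \<open>b \<in> Z_{[b,G]}\<close> by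
  construction. As \<open>b\<close> is not central, \<open>min\<close> applies to it.\<close>

lemma minimal_subset_gcomm_image:
  assumes min: "\<And>M. M \<lhd> G \<Longrightarrow> group_center G \<subset> ZN G M \<Longrightarrow> K \<subseteq> M"
    and b: "b \<in> carrier G" "b \<notin> group_center G"
    and c: "\<And>g. g \<in> carrier G \<Longrightarrow> gcomm G b g \<in> group_center G"
  shows "K \<subseteq> gcomm G b ` carrier G"
proof (rule min)
  show N: "gcomm G b ` carrier G \<lhd> G" by (rule gcomm_image_normal[OF b(1) c])
  have "b \<in> ZN G (gcomm G b ` carrier G)" unfolding normal.mem_ZN_iff[OF N] using b by auto
  then show "group_center G \<subset> ZN G (gcomm G b ` carrier G)"
    using normal.group_center_subset_ZN[OF N] b(2) by blast
qed

lemma minimal_central_exponent_prime: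
  assumes fin: "finite (carrier G)" and K: "K \<lhd> G" "K \<subseteq> group_center G"
    and min: "\<And>M. M \<lhd> G \<Longrightarrow> group_center G \<subset> ZN G M \<Longrightarrow> K \<subseteq> M"
    and strict: "group_center G \<subset> ZN G K"
  shows "\<exists>p::nat. Factorial_Ring.prime p \<and> (\<forall>x \<in> K. x [^] p = \<one>) \<and> (\<forall>b \<in> ZN G K. b [^] p \<in> group_center G)"
proof -
  interpret K: normal K G by fact
  \<comment> \<open>A noncentral \<open>a\<close> in Z_K has a nontrivial commutator
    \<open>y\<close> in \<open>K\<close>; \<open>p\<close> is a prime divisor of its order, and the
    power \<open>x0\<close> of \<open>y\<close> has order \<open>p\<close>.\<close>
  obtain a where a: "a \<in> ZN G K" "a \<notin> group_center G" using strict by blast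
  have aG: "a \<in> carrier G" and aK: "\<And>g. g \<in> carrier G \<Longrightarrow> gcomm G a g \<in> K"
    using a K.mem_ZN_iff by auto
  obtain g0 where g0: "g0 \<in> carrier G" "gcomm G a g0 \<noteq> \<one>" using a aG group_center_iff by auto
  define y where "y = gcomm G a g0"
  have y: "y \<in> K" "y \<noteq> \<one>" "y \<in> carrier G" unfolding y_def using g0 aK aG by auto
  have "ord y \<noteq> 1" using y ord_eq_1 by blast
  then obtain p where p: "Factorial_Ring.prime p" "p dvd ord y" using prime_factor_nat by blast
  have oy: "ord y > 0" using ord_ge_1[OF fin y(3)] by simp
  define x0 where "x0 = y [^] (ord y div p)"
  have x0K: "x0 \<in> K" unfolding x0_def using subgroup_pow_closed[OF K.subgroup_axioms y(1)] .
  have "ord y div p < ord y" "ord y div p > 0"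
    using oy p prime_gt_1_nat[OF p(1)] by (auto simp: div_greater_zero_iff dvd_imp_le)
  then have "\<not> ord y dvd ord y div p" using nat_dvd_not_less by blast
  then have x0: "x0 \<noteq> \<one>" unfolding x0_def using pow_eq_id[OF y(3)] by simp
  have x0p: "x0 [^] p = \<one>" unfolding x0_def using y(3) p(2) by (simp add: nat_pow_pow)
  have bp: "b [^] p \<in> group_center G" if b: "b \<in> ZN G K" for b
  proof (rule ccontr)
    assume nc: "b [^] p \<notin> group_center G"
    have bG: "b \<in> carrier G" and bK: "\<And>g. g \<in> carrier G \<Longrightarrow> gcomm G b g \<in> K"
      using b K.mem_ZN_iff by auto
    have pw: "gcomm G (b [^] p) g = gcomm G b g [^] p" if "g \<in> carrier G" for g
      using gcomm_pow_left[OF bG that] bK[OF that] K(2) by blast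
    have "gcomm G (b [^] p) g \<in> group_center G" if "g \<in> carrier G" for g
      unfolding pw[OF that] using subgroup_pow_closed[OF K.subgroup_axioms bK[OF that]] K(2) by blast
    \<comment> \<open>If \<open>b^p\<close> were not central, \<open>K\<close> would be contained in
      \<open>[b^p,G]\<close> and thus in the set of \<open>p\<close>-th powers of \<open>K\<close>.
      On the finite set \<open>K\<close> the power map would then be injective, but it sends both
      \<open>x0\<close> and 1 to 1.\<close>
    then have "K \<subseteq> gcomm G (b [^] p) ` carrier G"
      using minimal_subset_gcomm_image[OF min _ nc] bG by simp
    also have "\<dots> \<subseteq> (\<lambda>x. x [^] p) ` K" using pw bK by auto
    finally have "inj_on (\<lambda>x. x [^] p) K"
      using finite_surj_inj[of K "\<lambda>x. x [^] p"] fin K.subset finite_subset by blast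
    then have "x0 = \<one>" using inj_onD[of "\<lambda>x. x [^] p" K x0 \<one>] x0K x0p by simp
    then show False using x0 by simp
  qed
  have "x [^] p = \<one>" if x: "x \<in> K" for x
  proof -
    \<comment> \<open>Every \<open>x\<close> in \<open>K\<close> is a commutator
      \<open>[a,g]\<close>, so \<open>x^p = [a^p,g]\<close>, which is trivial because
      \<open>a^p\<close> is central.\<close>
    have "K \<subseteq> gcomm G a ` carrier G"
      using minimal_subset_gcomm_image[OF min aG a(2)] aK K(2) by blast
    then obtain g where g: "g \<in> carrier G" "x = gcomm G a g" using x by blast
    then have "x [^] p = gcomm G (a [^] p) g" using gcomm_pow_left[OF aG g(1)] subsetD[OF K(2) aK[OF g(1)]] by simp
    then show ?thesis using bp[OF a(1)] group_center_iff g by auto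
  qed
  then show ?thesis using p bp by blast
qed

lemma consecutive_exponents_equal:
  assumes K1: "K1 \<lhd> G" "K1 \<subseteq> group_center G" and K2: "K2 \<lhd> G" "K2 \<subseteq> ZN G K1"
    and min: "\<And>M. M \<lhd> G \<Longrightarrow> group_center G \<subset> ZN G M \<Longrightarrow> K1 \<subseteq> M"
    and strict: "group_center G \<subset> ZN G K1" "ZN G K1 \<subset> ZN G K2"
    and p: "Factorial_Ring.prime (p::nat)" "\<And>x. x \<in> K1 \<Longrightarrow> x [^] p = \<one>"
      "\<And>b. b \<in> ZN G K1 \<Longrightarrow> b [^] p \<in> group_center G"
    and q: "Factorial_Ring.prime (q::nat)" "\<And>x. x \<in> K2 \<Longrightarrow> x [^] q \<in> K1"
      "\<And>b. b \<in> ZN G K2 \<Longrightarrow> b [^] q \<in> ZN G K1"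
  shows "p = q"
proof (rule ccontr)
  assume "p \<noteq> q"
  then have cop: "coprime p q" using primes_coprime p(1) q(1) by blast
  interpret K1: normal K1 G by fact
  interpret K2: normal K2 G by fact
  \<comment> \<open>For \<open>x\<close> in \<open>K2\<close>, \<open>x^p\<close> is central because
    \<open>K2 \<le> Z_{K1}\<close>, and \<open>x^q\<close> because it lies in
    \<open>K1\<close>.\<close>
  have K2Z: "K2 \<subseteq> group_center G"
  proof
    fix x assume x: "x \<in> K2"
    have "x \<in> carrier G" using x K2.subset by auto
    moreover have "x [^] p \<in> group_center G" using p(3) x K2(2) by auto
    moreover have "x [^] q \<in> group_center G" using q(2)[OF x] K1(2) by auto
    ultimately show "x \<in> group_center G"
      by (rule mem_subgroup_if_coprime_pows[OF group_center_subgroup _ cop])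
  qed
  obtain a where a: "a \<in> ZN G K2" "a \<notin> ZN G K1" using strict(2) by blast
  have aG: "a \<in> carrier G" and aK: "\<And>g. g \<in> carrier G \<Longrightarrow> gcomm G a g \<in> K2"
    using a K2.mem_ZN_iff by auto
  have pw: "gcomm G (a [^] p) g = gcomm G a g [^] p" if "g \<in> carrier G" for g
    using gcomm_pow_left[OF aG that] aK[OF that] K2Z by blast
  have "a [^] p \<in> group_center G"
  proof (rule ccontr)
    assume nc: "a [^] p \<notin> group_center G"
    have "gcomm G (a [^] p) g \<in> group_center G" if "g \<in> carrier G" for g
      unfolding pw[OF that] using subgroup_pow_closed[OF K2.subgroup_axioms aK[OF that]] K2Z by blast
    then have sub: "K1 \<subseteq> gcomm G (a [^] p) ` carrier G"
      using minimal_subset_gcomm_image[OF min _ nc] aG by simp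
    \<comment> \<open>Here \<open>x = m^p\<close> with \<open>m\<close> in \<open>K2\<close>, so
      \<open>x^q = (m^q)^p = 1\<close> because \<open>m^q\<close> lies in \<open>K1\<close>; also
      \<open>x^p = 1\<close>. Hence \<open>K1\<close> is trivial, and Z_{K1} would be just the
      centre.\<close>
    have "x = \<one>" if x: "x \<in> K1" for x
    proof -
      obtain g where g: "g \<in> carrier G" "x = gcomm G a g [^] p" using sub x pw by blast
      define m where "m = gcomm G a g"
      have m: "m \<in> K2" "m \<in> carrier G" unfolding m_def using aK g aG by auto
      have xc: "x \<in> carrier G" using x K1.subset by blast
      have "x [^] q = (m [^] q) [^] p" unfolding g(2) m_def[symmetric] using m by (simp add: nat_pow_pow mult.commute)
      then have "x [^] q = \<one>" using p(2) q(2)[OF m(1)] by simp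
      then show ?thesis using mem_subgroup_if_coprime_pows[OF triv_subgroup xc cop] p(2)[OF x] by simp
    qed
    then have "ZN G K1 \<subseteq> group_center G"
      using K1.mem_ZN_iff group_center_iff by auto
    then show False using strict(1) by blast
  qed
  then have "a [^] p \<in> ZN G K1" using strict(1) by blast
  then show False
    using mem_subgroup_if_coprime_pows[OF normal_imp_subgroup[OF K1.ZN_normal] aG cop] q(3)[OF a(1)] a(2) by blast
qed

end

section \<open>The series of the K_i\<close>

lemma rep_kernel_normal:
  assumes H: "group H" and rep: "is_rep H n \<rho>"
  shows "{x \<in> carrier H. \<rho> x = 1\<^sub>m n} \<lhd> H"
proof -
  interpret group H by fact
  note r = is_repD[OF rep]
  have inv: "\<rho> x * \<rho> (inv\<^bsub>H\<^esub> x) = 1\<^sub>m n" if "x \<in> carrier H" for x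
    using r(3)[of x "inv\<^bsub>H\<^esub> x"] that r(2) by simp
  show ?thesis
  proof (rule normal_invI)
    show "subgroup {x \<in> carrier H. \<rho> x = 1\<^sub>m n} H"
    proof
      show "inv\<^bsub>H\<^esub> x \<in> {x \<in> carrier H. \<rho> x = 1\<^sub>m n}" if "x \<in> {x \<in> carrier H. \<rho> x = 1\<^sub>m n}" for x
        using inv[of x] that r(1)[of "inv\<^bsub>H\<^esub> x"] by auto
    qed (use r in auto)
    fix x h assume x: "x \<in> carrier H" and h: "h \<in> {x \<in> carrier H. \<rho> x = 1\<^sub>m n}"
    then have "\<rho> (x \<otimes>\<^bsub>H\<^esub> h \<otimes>\<^bsub>H\<^esub> inv\<^bsub>H\<^esub> x) = 1\<^sub>m n"
      using r(3)[of "x \<otimes>\<^bsub>H\<^esub> h" "inv\<^bsub>H\<^esub> x"] r(3)[of x h] inv[OF x] r(1)[OF x] by simp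
    then show "x \<otimes>\<^bsub>H\<^esub> h \<otimes>\<^bsub>H\<^esub> inv\<^bsub>H\<^esub> x \<in> {x \<in> carrier H. \<rho> x = 1\<^sub>m n}" using x h by simp
  qed
qed

text \<open>With \<open>N\<close> the kernel of \<open>\<rho>\<close>, this turns the condition for
  \<open>z\<close> to lie in Z_N into commutation of \<open>\<rho> z\<close> with all
  \<open>\<rho> h\<close>.\<close>

lemma rep_gcomm_one_iff:
  assumes H: "group H" and rep: "is_rep H n \<rho>" and z: "z \<in> carrier H" and h: "h \<in> carrier H"
  shows "\<rho> (gcomm H z h) = 1\<^sub>m n \<longleftrightarrow> \<rho> z * \<rho> h = \<rho> h * \<rho> z"
proof -
  interpret group H by fact
  note r = is_repD[OF rep]
  let ?c = "gcomm H z h"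
  have c: "?c \<in> carrier H" using z h by simp
  have hz: "h \<otimes>\<^bsub>H\<^esub> z \<in> carrier H" using z h by simp
  have e: "\<rho> z * \<rho> h = \<rho> ?c * (\<rho> h * \<rho> z)"
    using arg_cong[OF mult_eq_gcomm[OF z h], of \<rho>] r(3) z h c by (simp add: m_assoc)
  show ?thesis
  proof
    assume "\<rho> ?c = 1\<^sub>m n"
    then show "\<rho> z * \<rho> h = \<rho> h * \<rho> z" using e r(1)[OF h] r(1)[OF z] by simp
  next
    assume "\<rho> z * \<rho> h = \<rho> h * \<rho> z"
    then have "\<rho> (h \<otimes>\<^bsub>H\<^esub> z) = \<rho> ?c * \<rho> (h \<otimes>\<^bsub>H\<^esub> z)" using e r(3)[OF h z] by simp
    then have "\<rho> (h \<otimes>\<^bsub>H\<^esub> z \<otimes>\<^bsub>H\<^esub> inv\<^bsub>H\<^esub> (h \<otimes>\<^bsub>H\<^esub> z)) = \<rho> (?c \<otimes>\<^bsub>H\<^esub> (h \<otimes>\<^bsub>H\<^esub> z) \<otimes>\<^bsub>H\<^esub> inv\<^bsub>H\<^esub> (h \<otimes>\<^bsub>H\<^esub> z))"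
      using r(3)[OF hz inv_closed[OF hz]] r(3)[OF m_closed[OF c hz] inv_closed[OF hz]] r(3)[OF c hz] by simp
    then show "\<rho> ?c = 1\<^sub>m n" using r(2) c hz by (simp add: m_assoc del: inv_mult_group)
  qed
qed

text \<open>For abelian \<open>H\<close> no such \<open>N\<close> exists, in accordance with \<open>K(H) = H\<close>.\<close>

lemma mem_KK_iff:
  assumes H: "group H" "finite (carrier H)"
  shows "x \<in> KK H \<longleftrightarrow> x \<in> carrier H \<and> (\<forall>N. N \<lhd> H \<longrightarrow> group_center H \<subset> ZN H N \<longrightarrow> x \<in> N)"
proof (cases "comm_group H")
  case True
  interpret comm_group H by fact
  have "group_center H = carrier H" unfolding group_center_def using m_comm by auto
  moreover have "ZN H N \<subseteq> carrier H" if "N \<lhd> H" for N using normal.mem_ZN_iff[OF that] by auto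
  ultimately show ?thesis unfolding KK_def using True by auto
next
  case False
  interpret group H by fact
  show ?thesis
  proof (intro iffI conjI allI impI)
    assume "x \<in> KK H"
    then have x: "x \<in> carrier H" and ker: "\<And>\<chi>. \<chi> \<in> XX H \<Longrightarrow> x \<in> char_ker H \<chi>"
      unfolding KK_def using False by auto
    show "x \<in> carrier H" by fact
    fix N assume N: "N \<lhd> H" and Z: "group_center H \<subset> ZN H N"
    show "x \<in> N"
    proof (rule ccontr)
      assume "x \<notin> N"
      \<comment> \<open>An irreducible representation trivial on \<open>N\<close> but not at
        \<open>x\<close>: its character is to be shown to lie in \<open>XX H\<close>, so
        \<open>x\<close> must be in its kernel, a contradiction.\<close>
      then obtain n \<rho> where irr: "irreducible_rep H n \<rho>" and triv: "\<And>y. y \<in> N \<Longrightarrow> \<rho> y = 1\<^sub>m n"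
        and rx: "\<rho> x \<noteq> 1\<^sub>m n"
        using irreducible_rep_separates[OF H N x] by blast
      have rep: "is_rep H n \<rho>" and n: "n > 0" using irr unfolding irreducible_rep_def by auto
      note r = is_repD[OF rep]
      define \<chi> where "\<chi> = (\<lambda>g. if g \<in> carrier H then mat_trace (\<rho> g) else 0)"
      have \<chi>1: "\<chi> \<one>\<^bsub>H\<^esub> = of_nat n" unfolding \<chi>_def r(2) by simp
      have "\<chi> \<in> Irr H" unfolding Irr_def \<chi>_def using irr by blast
      \<comment> \<open>Commutators of \<open>z\<close> lie in \<open>N\<close> and act trivially,
        so by Schur's lemma \<open>\<rho> z\<close> is a scalar. The scalar is a root of unity, so
        \<open>|\<chi>(z)|\<close> equals the degree.\<close>
      moreover have "ZN H N \<subseteq> char_center H \<chi>"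
      proof
        fix z assume z: "z \<in> ZN H N"
        then have zc: "z \<in> carrier H" and zN: "\<And>h. h \<in> carrier H \<Longrightarrow> gcomm H z h \<in> N"
          using normal.mem_ZN_iff[OF N] by auto
        have "\<rho> z * \<rho> h = \<rho> h * \<rho> z" if "h \<in> carrier H" for h
          using rep_gcomm_one_iff[OF H(1) rep zc that] triv[OF zN[OF that]] by simp
        then obtain c where c: "\<rho> z = c \<cdot>\<^sub>m 1\<^sub>m n" using schur_scalar[OF irr r(1)[OF zc]] by blast
        have "upper_triangular (c \<cdot>\<^sub>m 1\<^sub>m n)" by (rule upper_triangularI) auto
        then have "(\<rho> z ^\<^sub>m k) $$ (0,0) = c ^ k" for k
          using upper_triangular_pow[of "\<rho> z" n k] n unfolding c by simp
        then have "c ^ Coset.order H = 1"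
          using rep_finite_order(1)[OF H rep zc] n by (metis index_one_mat(1))
        then have "cmod c ^ Coset.order H = 1" by (metis norm_power norm_one)
        then have "cmod c = 1"
          using power_eq_imp_eq_base[of "cmod c" "Coset.order H" 1] rep_finite_order(2)[OF H rep zc] by simp
        then have "cmod (\<chi> z) = cmod (\<chi> \<one>\<^bsub>H\<^esub>)"
          unfolding \<chi>1 using zc by (simp add: \<chi>_def c norm_mult)
        then show "z \<in> char_center H \<chi>" unfolding char_center_def using zc by simp
      qed
      ultimately have "\<chi> \<in> XX H" unfolding XX_def using Z by blast
      then have "\<chi> x = \<chi> \<one>\<^bsub>H\<^esub>" using ker unfolding char_ker_def by blast
      then have "mat_trace (\<rho> x) = of_nat n" unfolding \<chi>1 using x by (simp add: \<chi>_def)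
      then show False using rep_trace_imp_one[OF H rep x] rx by blast
    qed
  next
    assume a: "x \<in> carrier H \<and> (\<forall>N. N \<lhd> H \<longrightarrow> group_center H \<subset> ZN H N \<longrightarrow> x \<in> N)"
    then have x: "x \<in> carrier H" by simp
    have "x \<in> char_ker H \<chi>" if X: "\<chi> \<in> XX H" for \<chi>
    proof -
      obtain n \<rho> where irr: "irreducible_rep H n \<rho>"
        and \<chi>: "\<chi> = (\<lambda>g. if g \<in> carrier H then mat_trace (\<rho> g) else 0)"
        using X unfolding XX_def Irr_def by blast
      have rep: "is_rep H n \<rho>" using irr unfolding irreducible_rep_def by auto
      note r = is_repD[OF rep]
      define N where "N = {x \<in> carrier H. \<rho> x = 1\<^sub>m n}"
      have N: "N \<lhd> H" unfolding N_def by (rule rep_kernel_normal[OF H(1) rep])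
      \<comment> \<open>A trace of maximal modulus makes \<open>\<rho> z\<close> scalar, so it
        commutes with every \<open>\<rho> h\<close>, and all commutators of \<open>z\<close> fall
        into the kernel \<open>N\<close>.\<close>
      have "char_center H \<chi> \<subseteq> ZN H N"
      proof
        fix z assume z: "z \<in> char_center H \<chi>"
        then have zc: "z \<in> carrier H" and "cmod (mat_trace (\<rho> z)) = real n"
          unfolding char_center_def \<chi> using r(2) by auto
        then obtain c where c: "\<rho> z = c \<cdot>\<^sub>m 1\<^sub>m n" using rep_trace_norm_imp_scalar[OF H rep zc] by blast
        have "\<rho> z * \<rho> h = \<rho> h * \<rho> z" if h: "h \<in> carrier H" for h
          unfolding c using r(1)[OF h]
          by (simp add: mult_smult_distrib[OF r(1)[OF h] one_carrier_mat] mult_smult_assoc_mat[OF one_carrier_mat r(1)[OF h]])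
        then show "z \<in> ZN H N"
          unfolding normal.mem_ZN_iff[OF N] using rep_gcomm_one_iff[OF H(1) rep zc] zc by (simp add: N_def)
      qed
      then have "group_center H \<subset> ZN H N" using X unfolding XX_def by blast
      then have "x \<in> N" using a N by blast
      then show ?thesis unfolding char_ker_def \<chi> N_def using r(2) by simp
    qed
    then show "x \<in> KK H" unfolding KK_def using False x by auto
  qed
qed

lemma KK_normal:
  assumes H: "group H" "finite (carrier H)"
  shows "KK H \<lhd> H"
proof -
  interpret group H by fact
  \<comment> \<open>Inserting \<open>carrier H\<close> keeps the family nonempty, which the
    intersection needs when no proper candidate exists, for instance for abelian
    \<open>H\<close>.\<close>
  define F where "F = insert (carrier H) {N. N \<lhd> H \<and> group_center H \<subset> ZN H N}"
  have F: "N \<lhd> H" if "N \<in> F" for N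
    using that normal_invI[OF subgroup_self] unfolding F_def by auto
  have K: "KK H = \<Inter>F" unfolding F_def using mem_KK_iff[OF H] by auto
  have "F \<noteq> {}" unfolding F_def by simp
  then have "subgroup (\<Inter>F) H" using subgroups_Inter[of F] F normal_imp_subgroup by blast
  then show ?thesis
    unfolding K using F normal.inv_op_closed2 by (intro normal_invI) fastforce+
qed

declare Kseq.simps(2) [simp del]

section \<open>The terms K_i of the series and single steps, studied in G / K_i\<close>

context
  fixes G :: "('a, 'b) monoid_scheme" (structure)
  assumes G: "group G" and fin: "finite (carrier G)"
begin

interpretation group G by (rule G)

lemma finite_FactGroup: "finite (carrier (G Mod N))"
  unfolding carrier_FactGroup using fin by simp

lemma Kseq_normal: "Kseq G i \<lhd> G"
proof (induction i)
  case 0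
  show ?case using one_is_normal by simp
next
  case (Suc i)
  then show ?case
    using normal.factgroup_subgroup_union_normal[OF Suc] KK_normal[OF normal.factorgroup_is_group[OF Suc] finite_FactGroup]
    by (simp add: Kseq.simps(2))
qed

lemma KK_FactGroup_subset: "KK (G Mod Kseq G i) \<subseteq> carrier (G Mod Kseq G i)"
  using mem_KK_iff[OF normal.factorgroup_is_group[OF Kseq_normal] finite_FactGroup] by auto

text \<open>Recovers the defining relation \<open>K_{i+1} / K_i = K(G / K_i)\<close> from the
  encoding of \<open>K_{i+1}\<close> as a union of cosets.\<close>

lemma coset_image_Kseq_Suc: "(\<lambda>x. Kseq G i #> x) ` Kseq G (Suc i) = KK (G Mod Kseq G i)"
proof -
  interpret K: normal "Kseq G i" G by (rule Kseq_normal)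
  have "x \<in> Kseq G (Suc i) \<longleftrightarrow> x \<in> carrier G \<and> Kseq G i #> x \<in> KK (G Mod Kseq G i)" for x
    using K.mem_Union_iff_coset[OF KK_FactGroup_subset] by (simp add: Kseq.simps(2))
  then show ?thesis using KK_FactGroup_subset[of i] by (auto simp: carrier_FactGroup)
qed

lemma Kseq_subset_Suc: "Kseq G i \<subseteq> Kseq G (Suc i)"
proof
  interpret K: normal "Kseq G i" G by (rule Kseq_normal)
  fix x assume x: "x \<in> Kseq G i"
  then have xc: "x \<in> carrier G" using K.subset by blast
  have "Kseq G i #> x = \<one>\<^bsub>G Mod Kseq G i\<^esub>" using K.coset_eq_iff[OF xc] x by simp
  moreover have "\<one>\<^bsub>G Mod Kseq G i\<^esub> \<in> KK (G Mod Kseq G i)"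
    using normal_imp_subgroup[OF KK_normal[OF K.factorgroup_is_group finite_FactGroup]] subgroup.one_closed by blast
  ultimately show "x \<in> Kseq G (Suc i)"
    using K.mem_Union_iff_coset[OF KK_FactGroup_subset] xc by (simp add: Kseq.simps(2))
qed

lemma Kseq_mono: "i \<le> j \<Longrightarrow> Kseq G i \<subseteq> Kseq G j"
  by (rule lift_Suc_mono_le[of "Kseq G"]) (rule Kseq_subset_Suc)

lemma group_center_Mod_strict:
  assumes N: "N \<lhd> G" "M \<lhd> G" "N \<subseteq> M" and s: "ZN G N \<subset> ZN G M"
  shows "group_center (G Mod N) \<subset> ZN (G Mod N) ((\<lambda>x. N #> x) ` M)"
proof -
  interpret N: normal N G by fact
  have "group_center (G Mod N) \<subseteq> ZN (G Mod N) ((\<lambda>x. N #> x) ` M)"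
    by (rule normal.group_center_subset_ZN[OF N.normal_coset_image[OF N(2)]])
  moreover obtain a where a: "a \<in> ZN G M" "a \<notin> ZN G N" using s by blast
  moreover have "a \<in> carrier G" using a normal.mem_ZN_iff[OF N(2)] by blast
  ultimately show ?thesis
    using N.coset_mem_ZN_iff[OF N(2,3), of a] N.coset_mem_center_iff[of a] N.mem_ZN_iff[of a] by blast
qed

text \<open>Apply \<open>minimal_central_exponent_prime\<close> in \<open>G / K_i\<close> to the
  subgroup \<open>K_{i+1} / K_i\<close>. It is central by \<open>c\<close>, minimal by
  \<open>mem_KK_iff\<close> and enlarges the centre by \<open>s\<close>. The conclusions are then
  pulled back to \<open>G\<close>.\<close>

lemma Kseq_step_exponent:
  assumes s: "ZN G (Kseq G i) \<subset> ZN G (Kseq G (Suc i))"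
    and c: "\<And>x g. x \<in> Kseq G (Suc i) \<Longrightarrow> g \<in> carrier G \<Longrightarrow> gcomm G x g \<in> Kseq G i"
  shows "\<exists>p::nat. Factorial_Ring.prime p \<and> (\<forall>x \<in> Kseq G (Suc i). x [^] p \<in> Kseq G i) \<and>
           (\<forall>b \<in> ZN G (Kseq G (Suc i)). b [^] p \<in> ZN G (Kseq G i))"
proof -
  let ?N = "Kseq G i" and ?K = "Kseq G (Suc i)"
  interpret N: normal ?N G by (rule Kseq_normal)
  interpret K: normal ?K G by (rule Kseq_normal)
  interpret Q: group "G Mod ?N" by (rule N.factorgroup_is_group)
  note img = coset_image_Kseq_Suc[of i]
  have sub: "KK (G Mod ?N) \<subseteq> group_center (G Mod ?N)"
    unfolding img[symmetric]
  proof (rule image_subsetI)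
    fix x assume x: "x \<in> ?K"
    then show "?N #> x \<in> group_center (G Mod ?N)"
      using N.coset_mem_center_iff[of x] c K.subset by blast
  qed
  have min: "KK (G Mod ?N) \<subseteq> M" if "M \<lhd> (G Mod ?N)" "group_center (G Mod ?N) \<subset> ZN (G Mod ?N) M" for M
    using mem_KK_iff[OF Q.group_axioms finite_FactGroup] that by blast
  have st: "group_center (G Mod ?N) \<subset> ZN (G Mod ?N) (KK (G Mod ?N))"
    using group_center_Mod_strict[OF Kseq_normal Kseq_normal Kseq_subset_Suc s] unfolding img .
  obtain p :: nat where p: "Factorial_Ring.prime p" "\<And>x. x \<in> KK (G Mod ?N) \<Longrightarrow> x [^]\<^bsub>G Mod ?N\<^esub> p = \<one>\<^bsub>G Mod ?N\<^esub>"
    "\<And>b. b \<in> ZN (G Mod ?N) (KK (G Mod ?N)) \<Longrightarrow> b [^]\<^bsub>G Mod ?N\<^esub> p \<in> group_center (G Mod ?N)"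
    using Q.minimal_central_exponent_prime[OF finite_FactGroup KK_normal[OF Q.group_axioms finite_FactGroup] sub min st]
    by blast
  have "x [^] p \<in> ?N" if x: "x \<in> ?K" for x
  proof -
    have xc: "x \<in> carrier G" using x K.subset by blast
    have "?N #> x \<in> KK (G Mod ?N)" using x img by blast
    then show ?thesis using p(2) N.FactGroup_pow[OF xc, of p] N.coset_eq_iff[of "x [^] p"] xc by simp
  qed
  moreover have "b [^] p \<in> ZN G ?N" if b: "b \<in> ZN G ?K" for b
  proof -
    have bc: "b \<in> carrier G" using b K.mem_ZN_iff by blast
    have "?N #> b \<in> ZN (G Mod ?N) (KK (G Mod ?N))"
      using N.coset_mem_ZN_iff[OF Kseq_normal Kseq_subset_Suc bc] b unfolding img by blast
    from p(3)[OF this] have "?N #> b [^] p \<in> group_center (G Mod ?N)" unfolding N.FactGroup_pow[OF bc] .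
    then show ?thesis using N.coset_mem_center_iff[of "b [^] p"] N.mem_ZN_iff bc by simp
  qed
  ultimately show ?thesis using p(1) by blast
qed

text \<open>The quotient by \<open>K_i\<close> reduces this to
  \<open>consecutive_exponents_equal\<close> for the images of \<open>K_{i+1}\<close> and
  \<open>K_{i+2}\<close>; minimality is only asked of the first.\<close>

lemma Kseq_step_exponents_equal:
  assumes s: "ZN G (Kseq G i) \<subset> ZN G (Kseq G (Suc i))"
      "ZN G (Kseq G (Suc i)) \<subset> ZN G (Kseq G (Suc (Suc i)))"
    and c: "\<And>x g. x \<in> Kseq G (Suc i) \<Longrightarrow> g \<in> carrier G \<Longrightarrow> gcomm G x g \<in> Kseq G i"
      "\<And>x g. x \<in> Kseq G (Suc (Suc i)) \<Longrightarrow> g \<in> carrier G \<Longrightarrow> gcomm G x g \<in> Kseq G (Suc i)"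
    and p: "Factorial_Ring.prime (p::nat)" "\<And>x. x \<in> Kseq G (Suc i) \<Longrightarrow> x [^] p \<in> Kseq G i"
      "\<And>b. b \<in> ZN G (Kseq G (Suc i)) \<Longrightarrow> b [^] p \<in> ZN G (Kseq G i)"
    and q: "Factorial_Ring.prime (q::nat)" "\<And>x. x \<in> Kseq G (Suc (Suc i)) \<Longrightarrow> x [^] q \<in> Kseq G (Suc i)"
      "\<And>b. b \<in> ZN G (Kseq G (Suc (Suc i))) \<Longrightarrow> b [^] q \<in> ZN G (Kseq G (Suc i))"
  shows "p = q"
proof -
  define N where "N = Kseq G i"
  define K1 where "K1 = Kseq G (Suc i)"
  define K2 where "K2 = Kseq G (Suc (Suc i))"
  note defs = N_def[symmetric] K1_def[symmetric] K2_def[symmetric]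
  note s = s[unfolded defs] and c = c[unfolded defs] and p = p[unfolded defs] and q = q[unfolded defs]
  have NG: "N \<lhd> G" and K1G: "K1 \<lhd> G" and K2G: "K2 \<lhd> G"
    unfolding N_def K1_def K2_def by (rule Kseq_normal)+
  interpret N: normal N G by (rule NG)
  interpret K1: normal K1 G by (rule K1G)
  interpret K2: normal K2 G by (rule K2G)
  interpret Q: group "G Mod N" by (rule N.factorgroup_is_group)
  have N1: "N \<subseteq> K1" and N2: "N \<subseteq> K2"
    unfolding N_def K1_def K2_def by (rule Kseq_mono, simp)+
  let ?f = "\<lambda>x. N #> x"
  have img: "?f ` K1 = KK (G Mod N)" unfolding N_def K1_def by (rule coset_image_Kseq_Suc)
  \<comment> \<open>Elements of Z formed in the quotient have representatives in the corresponding Z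
    of \<open>G\<close>, to which the hypotheses on \<open>p\<close> and \<open>q\<close>
    apply.\<close>
  have pre: "\<exists>b \<in> ZN G M. B = ?f b" if M: "M \<lhd> G" "N \<subseteq> M" and B: "B \<in> ZN (G Mod N) (?f ` M)" for M B
  proof -
    have "B \<in> carrier (G Mod N)" using normal.mem_ZN_iff[OF N.normal_coset_image[OF M(1)]] B by blast
    then obtain b where "b \<in> carrier G" "B = ?f b" unfolding carrier_FactGroup by blast
    then show ?thesis using N.coset_mem_ZN_iff[OF M, of b] B by blast
  qed
  show ?thesis
  proof (rule Q.consecutive_exponents_equal[of "?f ` K1" "?f ` K2"])
    show "?f ` K1 \<lhd> (G Mod N)" "?f ` K2 \<lhd> (G Mod N)"
      by (rule N.normal_coset_image[OF K1G], rule N.normal_coset_image[OF K2G])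
    show "?f ` K1 \<subseteq> group_center (G Mod N)"
    proof (rule image_subsetI)
      fix x assume "x \<in> K1"
      then show "N #> x \<in> group_center (G Mod N)" using N.coset_mem_center_iff[of x] c(1) K1.subset by blast
    qed
    show "?f ` K2 \<subseteq> ZN (G Mod N) (?f ` K1)"
    proof (rule image_subsetI)
      fix x assume "x \<in> K2"
      then show "N #> x \<in> ZN (G Mod N) (?f ` K1)"
        using N.coset_mem_ZN_iff[OF K1G N1, of x] K1.mem_ZN_iff[of x] c(2) K2.subset by blast
    qed
    show "?f ` K1 \<subseteq> M" if "M \<lhd> (G Mod N)" "group_center (G Mod N) \<subset> ZN (G Mod N) M" for M
      unfolding img using mem_KK_iff[OF Q.group_axioms finite_FactGroup] that by blast
    show "group_center (G Mod N) \<subset> ZN (G Mod N) (?f ` K1)"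
      by (rule group_center_Mod_strict[OF NG K1G N1 s(1)])
    obtain a where a: "a \<in> ZN G K2" "a \<notin> ZN G K1" using s(2) by blast
    then have "a \<in> carrier G" using K2.mem_ZN_iff by blast
    then have "?f a \<in> ZN (G Mod N) (?f ` K2)" "?f a \<notin> ZN (G Mod N) (?f ` K1)"
      using N.coset_mem_ZN_iff[OF K2G N2] N.coset_mem_ZN_iff[OF K1G N1] a by auto
    moreover have "ZN (G Mod N) (?f ` K1) \<subseteq> ZN (G Mod N) (?f ` K2)"
      by (rule ZN_mono[OF N.normal_coset_image[OF K1G] N.normal_coset_image[OF K2G]])
         (use Kseq_subset_Suc[of "Suc i"] in \<open>auto simp: K1_def K2_def\<close>)
    ultimately show "ZN (G Mod N) (?f ` K1) \<subset> ZN (G Mod N) (?f ` K2)" by blast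
    show "Factorial_Ring.prime p" "Factorial_Ring.prime q" by fact+
    show "x [^]\<^bsub>G Mod N\<^esub> p = \<one>\<^bsub>G Mod N\<^esub>" if x: "x \<in> ?f ` K1" for x
    proof -
      obtain y where y: "y \<in> K1" "x = ?f y" using x by blast
      then have "y \<in> carrier G" using K1.subset by blast
      then show ?thesis using N.FactGroup_pow[of y p] N.coset_eq_iff[of "y [^] p"] p(2)[OF y(1)] y(2) by simp
    qed
    show "x [^]\<^bsub>G Mod N\<^esub> q \<in> ?f ` K1" if x: "x \<in> ?f ` K2" for x
    proof -
      obtain y where y: "y \<in> K2" "x = ?f y" using x by blast
      then have "y \<in> carrier G" using K2.subset by blast
      then show ?thesis using N.FactGroup_pow[of y q] q(2)[OF y(1)] y(2) by simp
    qed
    show "b [^]\<^bsub>G Mod N\<^esub> p \<in> group_center (G Mod N)" if b: "b \<in> ZN (G Mod N) (?f ` K1)" for b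
    proof -
      obtain y where y: "y \<in> ZN G K1" "b = ?f y" using pre[OF K1G N1 b] by blast
      then have yc: "y \<in> carrier G" using K1.mem_ZN_iff by blast
      then show ?thesis
        using N.FactGroup_pow[of y p] N.coset_mem_center_iff[of "y [^] p"] N.mem_ZN_iff p(3)[OF y(1)] y(2) by simp
    qed
    show "b [^]\<^bsub>G Mod N\<^esub> q \<in> ZN (G Mod N) (?f ` K1)" if b: "b \<in> ZN (G Mod N) (?f ` K2)" for b
    proof -
      obtain y where y: "y \<in> ZN G K2" "b = ?f y" using pre[OF K2G N2 b] by blast
      then have yc: "y \<in> carrier G" using K2.mem_ZN_iff by blast
      then show ?thesis
        using N.FactGroup_pow[of y q] N.coset_mem_ZN_iff[OF K1G N1, of "y [^] q"] q(3)[OF y(1)] y(2) by simp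
    qed
  qed
qed

section \<open>Subquotients A / B: orders, elementary abelian sections and chains\<close>

lemma subquot_order:
  assumes B: "B \<lhd> G" and A: "subgroup A G" and BA: "B \<subseteq> A"
  shows "group (subquot G A B)" and "Coset.order (subquot G A B) * card B = card A"
proof -
  let ?A = "G\<lparr>carrier := A\<rparr>"
  interpret A: group ?A by (rule subgroup.subgroup_is_group[OF A group_axioms])
  interpret B: normal B ?A by (rule normal_restrict_supergroup[OF A B BA])
  show "group (subquot G A B)" unfolding subquot_def by (rule B.factorgroup_is_group)
  show "Coset.order (subquot G A B) * card B = card A"
    using A.lagrange[OF B.subgroup_axioms] unfolding subquot_def
    by (simp add: Coset.order_def FactGroup_def)
qed

lemma elementary_abelian_subquot:
  assumes B: "B \<lhd> G" and A: "subgroup A G" and BA: "B \<subseteq> A" and p: "Factorial_Ring.prime p"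
    and c: "\<And>x y. x \<in> A \<Longrightarrow> y \<in> A \<Longrightarrow> gcomm G x y \<in> B"
    and e: "\<And>x. x \<in> A \<Longrightarrow> x [^] p \<in> B"
  shows "elementary_abelian_p_group p (subquot G A B)"
proof -
  let ?A = "G\<lparr>carrier := A\<rparr>" and ?Q = "subquot G A B"
  interpret A: group ?A by (rule subgroup.subgroup_is_group[OF A group_axioms])
  interpret B: normal B ?A by (rule normal_restrict_supergroup[OF A B BA])
  interpret Q: group ?Q by (rule subquot_order(1)[OF B A BA])
  have Qdef: "?Q = ?A Mod B" by (simp add: subquot_def)
  have carQ: "carrier ?Q = (\<lambda>x. B #>\<^bsub>?A\<^esub> x) ` A" unfolding Qdef carrier_FactGroup by simp
  have finQ: "finite (carrier ?Q)" unfolding carQ using subgroup.subset[OF A] fin finite_subset by blast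
  \<comment> \<open>Inverses in the subgroup agree with those in \<open>G\<close>, so the commutator
    hypothesis stated in \<open>G\<close> carries over.\<close>
  have gc: "gcomm ?A x y = gcomm G x y" if "x \<in> A" "y \<in> A" for x y
    using that A unfolding gcomm_def by (simp add: m_inv_consistent)
  have comm: "x \<otimes>\<^bsub>?Q\<^esub> y = y \<otimes>\<^bsub>?Q\<^esub> x" if xy: "x \<in> carrier ?Q" "y \<in> carrier ?Q" for x y
  proof -
    obtain u v where uv: "u \<in> A" "v \<in> A" "x = B #>\<^bsub>?A\<^esub> u" "y = B #>\<^bsub>?A\<^esub> v"
      using xy unfolding carQ by blast
    have "x \<in> group_center ?Q"
      unfolding Qdef uv(3) using B.coset_mem_center_iff[of u] uv(1) c gc by simp
    then show ?thesis using xy(2) unfolding group_center_def by blast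
  qed
  have cg: "comm_group ?Q" by (rule Q.group_comm_groupI[OF comm])
  have ex: "x [^]\<^bsub>?Q\<^esub> p = \<one>\<^bsub>?Q\<^esub>" if x: "x \<in> carrier ?Q" for x
  proof -
    obtain u where u: "u \<in> A" "x = B #>\<^bsub>?A\<^esub> u" using x unfolding carQ by blast
    have "u [^]\<^bsub>?A\<^esub> p \<in> B" using e[OF u(1)] by (simp flip: nat_pow_consistent)
    then show ?thesis
      unfolding Qdef u(2) using B.FactGroup_pow[of u p] B.coset_eq_iff[of "u [^]\<^bsub>?A\<^esub> p"] u(1) A.nat_pow_closed[of u p]
      by simp
  qed
  obtain a where "Coset.order ?Q = p ^ a"
    using Q.exponent_prime_imp_card_power[OF finQ p ex] by blast
  then show ?thesis
    unfolding elementary_abelian_p_group_def is_p_group_def using cg ex Q.group_axioms by blast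
qed

text \<open>Multiplicativity of indices, \<open>|A:C| = |A:B| |B:C|\<close>. The orders are compared
  after multiplication by \<open>card C\<close>, which is positive and cancels.\<close>

lemma is_p_group_subquot_trans:
  assumes "C \<lhd> G" "B \<lhd> G" "A \<lhd> G" "C \<subseteq> B" "B \<subseteq> A"
    and "is_p_group p (subquot G B C)" "is_p_group p (subquot G A B)"
  shows "is_p_group p (subquot G A C)"
proof -
  obtain a where a: "Coset.order (subquot G B C) = p ^ a" using assms unfolding is_p_group_def by blast
  obtain b where b: "Coset.order (subquot G A B) = p ^ b" using assms unfolding is_p_group_def by blast
  note s = normal_imp_subgroup
  have CA: "C \<subseteq> A" using assms by blast
  have "finite C" using assms(1) normal_imp_subgroup subgroup.subset fin finite_subset by metis
  moreover have "C \<noteq> {}" using subgroup.one_closed[OF s[OF assms(1)]] by blast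
  ultimately have pos: "card C > 0" by (simp add: card_gt_0_iff)
  have "Coset.order (subquot G A C) * card C = Coset.order (subquot G A B) * (Coset.order (subquot G B C) * card C)"
    using subquot_order(2)[OF assms(1) s[OF assms(2)] assms(4)] subquot_order(2)[OF assms(2) s[OF assms(3)] assms(5)]
      subquot_order(2)[OF assms(1) s[OF assms(3)] CA] by simp
  then have "Coset.order (subquot G A C) * card C = p ^ (a + b) * card C"
    unfolding a b by (auto simp: power_add mult.commute)
  then have "Coset.order (subquot G A C) = p ^ (a + b)" using pos by simp
  then show ?thesis
    unfolding is_p_group_def using subquot_order(1)[OF assms(1) s[OF assms(3)] CA] by blast
qed

lemma is_p_group_subquot_chain:
  assumes N: "\<And>i. F i \<lhd> G" and mono: "\<And>i. F i \<subseteq> F (Suc i)"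
    and step: "\<And>i. m \<le> i \<Longrightarrow> i < n \<Longrightarrow> is_p_group p (subquot G (F (Suc i)) (F i))" and "m < n"
  shows "is_p_group p (subquot G (F n) (F m))"
proof -
  \<comment> \<open>The induction starts at \<open>Suc m\<close>, where the claim is the hypothesis
    on the single step from \<open>m\<close>.\<close>
  have "Suc m \<le> n" using \<open>m < n\<close> by simp
  then show ?thesis using step
  proof (induction n rule: dec_induct)
    case base
    then show ?case by simp
  next
    case (step l)
    have "F m \<subseteq> F l" by (rule lift_Suc_mono_le[of F]) (use mono step in auto)
    then show ?case
      using is_p_group_subquot_trans[OF N[of m] N[of l] N[of "Suc l"] _ mono] step by simp
  qed
qed

end

theorem theoremF:
  fixes G :: "('a, 'b) monoid_scheme" and j k :: nat
  assumes "group G" and "finite (carrier G)"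
    and "1 \<le> j" and "j < k"
    and "\<And>i. j \<le> i \<Longrightarrow> i \<le> k \<Longrightarrow> ZN G (Kseq G (i - 1)) \<subset> ZN G (Kseq G i)"
    and "\<And>i. j \<le> i \<Longrightarrow> i \<le> k \<Longrightarrow>
           (\<forall>x \<in> Kseq G i. \<forall>g \<in> carrier G.
              x \<otimes>\<^bsub>G\<^esub> g \<otimes>\<^bsub>G\<^esub> inv\<^bsub>G\<^esub> x \<otimes>\<^bsub>G\<^esub> inv\<^bsub>G\<^esub> g \<in> Kseq G (i - 1))"
  shows "\<exists>p::nat. Factorial_Ring.prime p \<and>
           is_p_group p (subquot G (Kseq G k) (Kseq G (j - 1))) \<and>
           is_p_group p (subquot G (ZN G (Kseq G k)) (ZN G (Kseq G (j - 1)))) \<and>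
           (\<forall>i. j \<le> i \<and> i \<le> k \<longrightarrow>
              elementary_abelian_p_group p (subquot G (Kseq G i) (Kseq G (i - 1))) \<and>
              elementary_abelian_p_group p (subquot G (ZN G (Kseq G i)) (ZN G (Kseq G (i - 1)))))"
proof -
  interpret group G by fact
  note G = assms(1,2)
  \<comment> \<open>The shift \<open>m = j - 1\<close> replaces the pairs \<open>K_{i-1}\<close>,
    \<open>K_i\<close> with \<open>j \<le> i \<le> k\<close> by \<open>Kseq G i\<close>,
    \<open>Kseq G (Suc i)\<close> with \<open>m \<le> i < k\<close>.\<close>
  define m where "m = j - 1"
  have jm: "j = Suc m" using assms(3) unfolding m_def by simp
  have mk: "Suc m < k" using assms(4) jm by simp
  have s: "ZN G (Kseq G i) \<subset> ZN G (Kseq G (Suc i))" if "m \<le> i" "i < k" for i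
    using assms(5)[of "Suc i"] that jm by simp
  have c: "gcomm G x g \<in> Kseq G i" if "m \<le> i" "i < k" "x \<in> Kseq G (Suc i)" "g \<in> carrier G" for i x g
    using assms(6)[of "Suc i"] that jm unfolding gcomm_def by simp
  \<comment> \<open>\<open>P i p\<close> says that \<open>p\<close> is a prime exponent for step
    \<open>i\<close> in both series. Each step has such a prime, neighbouring steps share it, and
    induction spreads the prime of step \<open>m\<close> to all of them.\<close>
  define P where "P i p \<longleftrightarrow> Factorial_Ring.prime p \<and> (\<forall>x \<in> Kseq G (Suc i). x [^]\<^bsub>G\<^esub> p \<in> Kseq G i) \<and>
    (\<forall>b \<in> ZN G (Kseq G (Suc i)). b [^]\<^bsub>G\<^esub> p \<in> ZN G (Kseq G i))" for i and p :: nat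
  have ex: "\<exists>p. P i p" if "m \<le> i" "i < k" for i
    unfolding P_def by (rule Kseq_step_exponent[OF G s[OF that]]) (use c that in blast)
  have uniq: "p = q" if i: "m \<le> i" "Suc i < k" and p: "P i p" and q: "P (Suc i) q" for i p q
  proof (rule Kseq_step_exponents_equal[OF G s s])
    show "gcomm G x g \<in> Kseq G i" if "x \<in> Kseq G (Suc i)" "g \<in> carrier G" for x g
      using c[OF _ _ that] i by simp
    show "gcomm G x g \<in> Kseq G (Suc i)" if "x \<in> Kseq G (Suc (Suc i))" "g \<in> carrier G" for x g
      using c[OF _ _ that] i by simp
  qed (use i p q in \<open>auto simp: P_def\<close>)
  obtain p where p: "P m p" using ex[of m] mk by auto
  have all: "P i p" if "m \<le> i" "i < k" for i
    using that
  proof (induction i rule: dec_induct)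
    case base
    show ?case by (rule p)
  next
    case (step i)
    then have "P i p" by simp
    moreover obtain q where "P (Suc i) q" using ex[of "Suc i"] step by auto
    ultimately show ?case using uniq[of i p q] step by simp
  qed
  have prime: "Factorial_Ring.prime p" using p unfolding P_def by blast
  note KN = Kseq_normal[OF G]
  have ZNn: "ZN G (Kseq G i) \<lhd> G" for i by (rule normal.ZN_normal[OF KN])
  have Zmono: "ZN G (Kseq G i) \<subseteq> ZN G (Kseq G (Suc i))" for i
    by (rule ZN_mono[OF KN KN Kseq_subset_Suc[OF G]])
  \<comment> \<open>\<open>[K_{i+1},G] \<le> K_i\<close> says exactly that
    \<open>K_{i+1} \<le> Z_{K_i}\<close>. Commutators of elements of \<open>Z_{K_{i+1}}\<close> lie
    in \<open>K_{i+1}\<close>, so this inclusion makes \<open>Z_{K_{i+1}} / Z_{K_i}\<close>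
    abelian.\<close>
  have KZ: "Kseq G (Suc i) \<subseteq> ZN G (Kseq G i)" if "m \<le> i" "i < k" for i
    using normal.mem_ZN_iff[OF KN] c[OF that] subgroup.subset[OF normal_imp_subgroup[OF KN]] by blast
  have e1: "elementary_abelian_p_group p (subquot G (Kseq G (Suc i)) (Kseq G i))" if i: "m \<le> i" "i < k" for i
  proof (rule elementary_abelian_subquot[OF G KN normal_imp_subgroup[OF KN] Kseq_subset_Suc[OF G] prime])
    show "gcomm G x y \<in> Kseq G i" if "x \<in> Kseq G (Suc i)" "y \<in> Kseq G (Suc i)" for x y
      using c[OF i that(1)] that(2) subgroup.subset[OF normal_imp_subgroup[OF KN]] by blast
    show "x [^]\<^bsub>G\<^esub> p \<in> Kseq G i" if "x \<in> Kseq G (Suc i)" for x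
      using all[OF i] that unfolding P_def by blast
  qed
  have e2: "elementary_abelian_p_group p (subquot G (ZN G (Kseq G (Suc i))) (ZN G (Kseq G i)))"
    if i: "m \<le> i" "i < k" for i
  proof (rule elementary_abelian_subquot[OF G ZNn normal_imp_subgroup[OF ZNn] Zmono prime])
    show "gcomm G x y \<in> ZN G (Kseq G i)" if "x \<in> ZN G (Kseq G (Suc i))" "y \<in> ZN G (Kseq G (Suc i))" for x y
      using that normal.mem_ZN_iff[OF KN] KZ[OF i] by blast
    show "x [^]\<^bsub>G\<^esub> p \<in> ZN G (Kseq G i)" if "x \<in> ZN G (Kseq G (Suc i))" for x
      using all[OF i] that unfolding P_def by blast
  qed
  have "is_p_group p (subquot G (Kseq G k) (Kseq G m))"
    by (rule is_p_group_subquot_chain[OF G, of "Kseq G"])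
       (use KN Kseq_subset_Suc[OF G] e1 mk in \<open>auto simp: elementary_abelian_p_group_def\<close>)
  moreover have "is_p_group p (subquot G (ZN G (Kseq G k)) (ZN G (Kseq G m)))"
    by (rule is_p_group_subquot_chain[OF G, of "\<lambda>i. ZN G (Kseq G i)"])
       (use ZNn Zmono e2 mk in \<open>auto simp: elementary_abelian_p_group_def\<close>)
  moreover have "elementary_abelian_p_group p (subquot G (Kseq G i) (Kseq G (i - 1))) \<and>
      elementary_abelian_p_group p (subquot G (ZN G (Kseq G i)) (ZN G (Kseq G (i - 1))))"
    if "j \<le> i" "i \<le> k" for i
  proof -
    obtain l where "i = Suc l" "m \<le> l" "l < k" using \<open>j \<le> i\<close> \<open>i \<le> k\<close> jm by (cases i) auto
    then show ?thesis using e1[of l] e2[of l] by simp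
  qed
  ultimately show ?thesis using prime unfolding m_def by blast
qed

end
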